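(* Let $I\subseteq\mathbb{R}$ be an interval, $G:I\to(0,1)$ a continuous strictly increasing bijection, and $X,X_1,X_2,\ldots$ i.i.d. with law $P$, $P(I)=1$. Put $U=G(X)$, $U_i=G(X_i)$; for a fixed integer $q\ge1$ and $1\le r,s\le q$ let $p_r=\mathbb{E}[U^r]$, $\widehat p_r=\frac1n\sum_{i=1}^nU_i^r$, $(\Sigma_q)_{rs}=\operatorname{Cov}(U^r,U^s)$, $(\widehat\Sigma_q)_{rs}=\frac1{n-1}\sum_{i=1}^n(U_i^r-\widehat p_r)(U_i^s-\widehat p_s)$, $M_r=G^{-1}(p_r)$, $\widehat M_r=G^{-1}(\widehat p_r)$, $\mathbf M_q=(M_1,\ldots,M_q)^\top$, $\widehat{\mathbf M}_q=(\widehat M_1,\ldots,\widehat M_q)^\top$. If $G'$ is continuous and positive at $M_r$ for $r=1,\ldots,q$, then, as $n\to\infty$, $$\sqrt n(\widehat{\mathbf M}_q-\mathbf M_q)\rightsquigarrow\mathcal N_q(0,D_q\Sigma_qD_q),\qquad D_q=\operatorname{diag}\left(\frac1{G'(M_1)},\ldots,\frac1{G'(M_q)}\right),$$ and a consistent covariance estimator is $\widehat D_q\widehat\Sigma_q\widehat D_q$ with $\widehat D_q=\operatorname{diag}\left(\frac1{G'(\widehat M_1)},\ldots,\frac1{G'(\widehat M_q)}\right)$, i.e. $\widehat D_q\widehat\Sigma_q\widehat D_q\to D_q\Sigma_qD_q$ in probability.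
   Context: "$G'$ continuous at $M_r$" means $G$ is differentiable in a neighbourhood of $M_r$ with derivative continuous at $M_r$. If $G$ is not differentiable at $\widehat M_r$ or $G'(\widehat M_r)=0$, the corresponding entry of $\widehat D_q$ is set by convention to $0$. $\mathcal N_q(0,\Sigma)$ is the (possibly degenerate) normal law. The $M_r$ are called initial Kolmogorov moments. *)

theory Defs
  imports "HOL-Probability.Probability"
begin

definition weak_conv_rv ::
  "'w measure \<Rightarrow> (nat \<Rightarrow> 'w \<Rightarrow> 'b::euclidean_space) \<Rightarrow> 'b measure \<Rightarrow> bool" where
  "weak_conv_rv M Y N \<longleftrightarrow>
     (\<forall>n. Y n \<in> borel_measurable M) \<and>
     (\<forall>f::'b \<Rightarrow> real. continuous_on UNIV f \<and> bounded (range f) \<longrightarrow>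
        (\<lambda>n. \<integral>x. f x \<partial>distr M borel (Y n)) \<longlonglongrightarrow> (\<integral>x. f x \<partial>N))"

text \<open>Measurability is part of the definition because \<^const>\<open>measure\<close> is 0 on non-measurable
  sets.\<close>

definition conv_in_prob ::
  "'w measure \<Rightarrow> (nat \<Rightarrow> 'w \<Rightarrow> 'b::euclidean_space) \<Rightarrow> 'b \<Rightarrow> bool" where
  "conv_in_prob M Y L \<longleftrightarrow>
     (\<forall>n. Y n \<in> borel_measurable M) \<and>
     (\<forall>\<epsilon>>0. (\<lambda>n. measure M {\<omega> \<in> space M. dist (Y n \<omega>) L > \<epsilon>}) \<longlonglongrightarrow> 0)"

text \<open>Parametrised by the variance \<open>v \<ge> 0\<close>, whereas \<^const>\<open>normal_density\<close> takes the standard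
  deviation.\<close>

definition normal_law :: "real \<Rightarrow> real \<Rightarrow> real measure" where
  "normal_law m v =
     (if v = 0 then return borel m else density lborel (\<lambda>x. ennreal (normal_density m (sqrt v) x)))"

text \<open>\<open>N\<close> is the possibly degenerate normal law with mean \<open>\<mu>\<close> and covariance matrix \<open>S\<close>:
  every linear functional has the univariate normal law with the corresponding mean and variance.
  This determines \<open>N\<close>.\<close>

definition is_normal_law :: "(real ^ 'q) measure \<Rightarrow> real ^ 'q \<Rightarrow> real ^ 'q ^ 'q \<Rightarrow> bool" where
  "is_normal_law N \<mu> S \<longleftrightarrow>
     prob_space N \<and> sets N = sets borel \<and>
     transpose S = S \<and> (\<forall>t. 0 \<le> t \<bullet> (S *v t)) \<and>
     (\<forall>t. distr N borel (\<lambda>x. t \<bullet> x) = normal_law (t \<bullet> \<mu>) (t \<bullet> (S *v t)))"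

definition covariance :: "'w measure \<Rightarrow> ('w \<Rightarrow> real) \<Rightarrow> ('w \<Rightarrow> real) \<Rightarrow> real" where
  "covariance M Y Z =
     (\<integral>\<omega>. (Y \<omega> - (\<integral>\<omega>'. Y \<omega>' \<partial>M)) * (Z \<omega> - (\<integral>\<omega>'. Z \<omega>' \<partial>M)) \<partial>M)"

definition diag_mat :: "('q \<Rightarrow> real) \<Rightarrow> real ^ 'q ^ 'q" where
  "diag_mat d = (\<chi> i j. if i = j then d i else 0)"

text \<open>Throughout, \<open>X 0\<close> plays the role of \<open>X\<close> and \<open>X 1, X 2, \<dots>\<close> that of the sample.
  The coordinates of vectors are indexed by a finite type \<open>'q\<close>, and \<open>ix\<close> numbers
  them by \<open>1, \<dots>, q\<close>; the number is needed as an exponent.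

  Since \<open>G\<close> is total in HOL but meaningful only on \<open>I\<close>, and \<open>X\<close> lies in \<open>I\<close> only almost
  surely, \<open>U = G(X)\<close> is set to 0 on the null event \<open>X \<notin> I\<close>.\<close>

definition U_rv :: "real set \<Rightarrow> (real \<Rightarrow> real) \<Rightarrow> (nat \<Rightarrow> 'w \<Rightarrow> real) \<Rightarrow> nat \<Rightarrow> 'w \<Rightarrow> real" where
  "U_rv I G X i \<omega> = (if X i \<omega> \<in> I then G (X i \<omega>) else 0)"

definition p_mom ::
  "'w measure \<Rightarrow> real set \<Rightarrow> (real \<Rightarrow> real) \<Rightarrow> (nat \<Rightarrow> 'w \<Rightarrow> real) \<Rightarrow> nat \<Rightarrow> real" where
  "p_mom M I G X r = (\<integral>\<omega>. U_rv I G X 0 \<omega> ^ r \<partial>M)"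

definition p_hat ::
  "real set \<Rightarrow> (real \<Rightarrow> real) \<Rightarrow> (nat \<Rightarrow> 'w \<Rightarrow> real) \<Rightarrow> nat \<Rightarrow> nat \<Rightarrow> 'w \<Rightarrow> real" where
  "p_hat I G X n r \<omega> = (\<Sum>i=1..n. U_rv I G X i \<omega> ^ r) / real n"

definition Sigma_mat ::
  "('q \<Rightarrow> nat) \<Rightarrow> 'w measure \<Rightarrow> real set \<Rightarrow> (real \<Rightarrow> real) \<Rightarrow> (nat \<Rightarrow> 'w \<Rightarrow> real) \<Rightarrow> real ^ 'q ^ 'q" where
  "Sigma_mat ix M I G X =
     (\<chi> r s. covariance M (\<lambda>\<omega>. U_rv I G X 0 \<omega> ^ ix r) (\<lambda>\<omega>. U_rv I G X 0 \<omega> ^ ix s))"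

definition Sigma_hat ::
  "('q \<Rightarrow> nat) \<Rightarrow> real set \<Rightarrow> (real \<Rightarrow> real) \<Rightarrow> (nat \<Rightarrow> 'w \<Rightarrow> real) \<Rightarrow> nat \<Rightarrow> 'w \<Rightarrow> real ^ 'q ^ 'q" where
  "Sigma_hat ix I G X n \<omega> =
     (\<chi> r s. (\<Sum>i=1..n. (U_rv I G X i \<omega> ^ ix r - p_hat I G X n (ix r) \<omega>) *
                      (U_rv I G X i \<omega> ^ ix s - p_hat I G X n (ix s) \<omega>)) / (real n - 1))"

definition K_mom ::
  "'w measure \<Rightarrow> real set \<Rightarrow> (real \<Rightarrow> real) \<Rightarrow> (nat \<Rightarrow> 'w \<Rightarrow> real) \<Rightarrow> nat \<Rightarrow> real" where
  "K_mom M I G X r = inv_into I G (p_mom M I G X r)"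

definition K_hat ::
  "real set \<Rightarrow> (real \<Rightarrow> real) \<Rightarrow> (nat \<Rightarrow> 'w \<Rightarrow> real) \<Rightarrow> nat \<Rightarrow> nat \<Rightarrow> 'w \<Rightarrow> real" where
  "K_hat I G X n r \<omega> = inv_into I G (p_hat I G X n r \<omega>)"

definition K_vec ::
  "('q \<Rightarrow> nat) \<Rightarrow> 'w measure \<Rightarrow> real set \<Rightarrow> (real \<Rightarrow> real) \<Rightarrow> (nat \<Rightarrow> 'w \<Rightarrow> real) \<Rightarrow> real ^ 'q" where
  "K_vec ix M I G X = (\<chi> r. K_mom M I G X (ix r))"

definition K_hat_vec ::
  "('q \<Rightarrow> nat) \<Rightarrow> real set \<Rightarrow> (real \<Rightarrow> real) \<Rightarrow> (nat \<Rightarrow> 'w \<Rightarrow> real) \<Rightarrow> nat \<Rightarrow> 'w \<Rightarrow> real ^ 'q" where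
  "K_hat_vec ix I G X n \<omega> = (\<chi> r. K_hat I G X n (ix r) \<omega>)"

definition D_mat ::
  "('q \<Rightarrow> nat) \<Rightarrow> 'w measure \<Rightarrow> real set \<Rightarrow> (real \<Rightarrow> real) \<Rightarrow> (nat \<Rightarrow> 'w \<Rightarrow> real) \<Rightarrow> real ^ 'q ^ 'q" where
  "D_mat ix M I G X = diag_mat (\<lambda>r. 1 / deriv G (K_mom M I G X (ix r)))"

definition D_hat ::
  "('q \<Rightarrow> nat) \<Rightarrow> real set \<Rightarrow> (real \<Rightarrow> real) \<Rightarrow> (nat \<Rightarrow> 'w \<Rightarrow> real) \<Rightarrow> nat \<Rightarrow> 'w \<Rightarrow> real ^ 'q ^ 'q" where
  "D_hat ix I G X n \<omega> = diag_mat (\<lambda>r.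
     let x = K_hat I G X n (ix r) \<omega>
     in if G differentiable (at x) \<and> deriv G x \<noteq> 0 then 1 / deriv G x else 0)"

text \<open>\<open>G'\<close> is continuous at \<open>x\<close> in the sense that \<open>G\<close> is differentiable in a neighbourhood
  of \<open>x\<close> with derivative continuous at \<open>x\<close>. At points of \<open>I\<close> this does not depend on \<open>G\<close>
  off \<open>I\<close>: an interval carrying a continuous increasing bijection onto \<open>(0, 1)\<close> is open.\<close>

definition deriv_continuous_at :: "(real \<Rightarrow> real) \<Rightarrow> real \<Rightarrow> bool" where
  "deriv_continuous_at G x \<longleftrightarrow> (\<forall>\<^sub>F y in nhds x. G differentiable (at y)) \<and> isCont (deriv G) x"

end

(*
  The centred empirical moments form a normalised sum of i.i.d. bounded vectors, so they satisfy a
  multivariate central limit theorem. Since G is continuously differentiable with positive derivative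
  at M_r, the difference quotient of the inverse of G, extended by 1 / G'(M_r) at p_r, is continuous at
  p_r. Hence sqrt n (hat M_r - M_r) is 1 / G'(M_r) times sqrt n (hat p_r - p_r) up to a tight sequence
  times one that tends to 0 in probability, and Slutsky's theorem applies. The covariance estimator is
  a function of finitely many empirical moments that is continuous at their limits.

  Multivariate weak convergence is reduced to the univariate central limit theorem: tightness and
  convergence of the expectations of cos (t . x + b) suffice, because on a large box every test function
  is uniformly close to a trigonometric polynomial with the same global bound, up to a small error.

  The estimator involves G' at random points. It is measurable because differentiability on the open
  interval I amounts to a Cauchy condition on difference quotients, which defines a Borel set.
*)
theory Submission
  imports Defs
begin

subsection \<open>Trigonometric polynomials\<close>

text \<open>Cosines \<open>cos (t \<bullet> x + b)\<close> are the right test functions because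
  their expectation depends only on the law of \<open>t \<bullet> x\<close>. This is the Cramer-Wold
  device, and it fits \<open>is_normal_law\<close>, which prescribes nothing but these
  one-dimensional laws. A prescription does not by itself produce a measure, so the limit law is
  constructed, as a linear image of independent standard normal variables; singular covariance
  matrices are thereby included. A further obstacle is that every member of a sequence has to be a
  random vector on the whole sample space. The empirical moment can leave \<open>(0, 1)\<close>: it
  is 0 at \<open>n = 0\<close> and wherever all sample points miss \<open>I\<close>, and there
  \<open>inv_into\<close> returns an arbitrary point. Limits are therefore taken with globally
  defined Borel functions that are continuous at the limit point, instead of restricting to a good
  event. The passage from moments to their inverse images is made one coordinate at a time, since
  convergence in probability can be checked on coordinates.\<close>

inductive trig_polynomial :: "('a::real_inner \<Rightarrow> real) \<Rightarrow> bool" where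
  cos: "trig_polynomial (\<lambda>x. cos (t \<bullet> x + b))"
| add: "trig_polynomial f \<Longrightarrow> trig_polynomial g \<Longrightarrow> trig_polynomial (\<lambda>x. f x + g x)"
| scale: "trig_polynomial f \<Longrightarrow> trig_polynomial (\<lambda>x. c * f x)"

lemma trig_polynomial_const: "trig_polynomial (\<lambda>x. c)"
  using trig_polynomial.scale[OF trig_polynomial.cos[of 0 0], of c] by simp

lemma trig_polynomial_sum:
  "(\<And>i. i \<in> A \<Longrightarrow> trig_polynomial (f i)) \<Longrightarrow> trig_polynomial (\<lambda>x. \<Sum>i\<in>A. f i x)"
  by (induction A rule: infinite_finite_induct)
     (auto intro: trig_polynomial_const trig_polynomial.add)

text \<open>The product-to-sum formula adds and subtracts frequencies and phases, so the span of the
  generators is an algebra. Polynomials in the torus coordinates need this.\<close>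

lemma trig_polynomial_cos_mult:
  assumes "trig_polynomial g"
  shows "trig_polynomial (\<lambda>x. cos (t \<bullet> x + b) * g x)"
  using assms
proof induction
  case (cos s c)
  have "trig_polynomial (\<lambda>x. (1/2) * cos ((t - s) \<bullet> x + (b - c)) + (1/2) * cos ((t + s) \<bullet> x + (b + c)))"
    by (intro trig_polynomial.intros)
  also have "(\<lambda>x. (1/2) * cos ((t - s) \<bullet> x + (b - c)) + (1/2) * cos ((t + s) \<bullet> x + (b + c)))
      = (\<lambda>x. cos (t \<bullet> x + b) * cos (s \<bullet> x + c))"
    by (simp add: cos_times_cos inner_diff_left inner_add_left algebra_simps add_divide_distrib)
  finally show ?case .
next
  case (add f g)
  then show ?case
    using trig_polynomial.add[OF add.IH] by (simp add: algebra_simps)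
next
  case (scale f c)
  then show ?case
    using trig_polynomial.scale[OF scale.IH, of c] by (simp add: algebra_simps)
qed

lemma trig_polynomial_mult:
  assumes "trig_polynomial f" "trig_polynomial g"
  shows "trig_polynomial (\<lambda>x. f x * g x)"
  using assms(1)
proof induction
  case (cos t b)
  then show ?case using trig_polynomial_cos_mult[OF assms(2)] .
next
  case (add f h)
  then show ?case
    using trig_polynomial.add[OF add.IH] by (simp add: algebra_simps)
next
  case (scale f c)
  then show ?case
    using trig_polynomial.scale[OF scale.IH, of c] by (simp add: algebra_simps)
qed

lemma trig_polynomial_bounded_continuous:
  assumes "trig_polynomial f"
  shows "continuous_on UNIV f \<and> (\<exists>B. \<forall>x. \<bar>f x\<bar> \<le> B)"
  using assms
proof induction
  case (cos t b)
  have "\<forall>x. \<bar>cos (t \<bullet> x + b)\<bar> \<le> 1" by simp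
  moreover have "continuous_on UNIV (\<lambda>x. cos (t \<bullet> x + b))"
    by (intro continuous_intros)
  ultimately show ?case by blast
next
  case (add f g)
  then obtain B C where "\<forall>x. \<bar>f x\<bar> \<le> B" "\<forall>x. \<bar>g x\<bar> \<le> C" by blast
  then have "\<forall>x. \<bar>f x + g x\<bar> \<le> B + C" by (meson abs_triangle_ineq add_mono order_trans)
  then show ?case using add by (auto intro!: continuous_intros)
next
  case (scale f c)
  then obtain B where "\<forall>x. \<bar>f x\<bar> \<le> B" by blast
  then have "\<forall>x. \<bar>c * f x\<bar> \<le> \<bar>c\<bar> * B" by (simp add: abs_mult mult_left_mono)
  then show ?case using scale by (auto intro!: continuous_intros)
qed

text \<open>Each coordinate is wrapped around the unit circle with period \<open>2 * A\<close>; the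
  cosines form the first component and the sines the second. The image is a product of circles
  inside a Euclidean space, where polynomial functions are available.\<close>

definition torus_map :: "real \<Rightarrow> 'a::euclidean_space \<Rightarrow> 'a \<times> 'a" where
  "torus_map A x = (\<Sum>b\<in>Basis. cos (pi / A * (x \<bullet> b)) *\<^sub>R b, \<Sum>b\<in>Basis. sin (pi / A * (x \<bullet> b)) *\<^sub>R b)"

lemma continuous_on_torus_map: "continuous_on S (torus_map A)"
  unfolding torus_map_def by (intro continuous_intros)

lemma torus_map_eq_iff:
  "torus_map A x = torus_map A y \<longleftrightarrow>
     (\<forall>b\<in>Basis. cos (pi / A * (x \<bullet> b)) = cos (pi / A * (y \<bullet> b)) \<and> sin (pi / A * (x \<bullet> b)) = sin (pi / A * (y \<bullet> b)))"
  unfolding torus_map_def prod.inject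
  by (subst (1 2) euclidean_eq_iff) (auto simp: inner_sum_left inner_Basis if_distrib cong: if_cong)

lemma trig_polynomial_torus_map:
  fixes g :: "'a::euclidean_space \<times> 'a \<Rightarrow> real"
  assumes "real_polynomial_function g"
  shows "trig_polynomial (\<lambda>x. g (torus_map A x))"
  using assms
proof induction
  case (linear f)
  interpret f: bounded_linear f by fact
  \<comment> \<open>Sine is the cosine with phase \<open>- pi / 2\<close>; this is why the
    generators carry a phase.\<close>
  have eq: "f (torus_map A x) = (\<Sum>b\<in>Basis. f (b, 0) * cos ((pi / A) *\<^sub>R b \<bullet> x + 0))
      + (\<Sum>b\<in>Basis. f (0, b) * cos ((pi / A) *\<^sub>R b \<bullet> x + (- pi / 2)))" for x :: 'a
  proof -
    have split: "torus_map A x = (\<Sum>b\<in>Basis. cos (pi / A * (x \<bullet> b)) *\<^sub>R (b, 0)) +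
        (\<Sum>b\<in>Basis. sin (pi / A * (x \<bullet> b)) *\<^sub>R (0, b))"
      unfolding torus_map_def by (simp add: prod_eq_iff fst_sum snd_sum)
    have "cos (t - pi / 2) = sin t" for t :: real
      by (simp add: cos_diff)
    then show ?thesis
      unfolding split f.add f.sum f.scaleR
      by (simp add: inner_commute mult.commute)
  qed
  show ?case unfolding eq by (intro trig_polynomial.intros trig_polynomial_sum)
next
  case (const c)
  then show ?case by (rule trig_polynomial_const)
next
  case (add f g)
  then show ?case by (intro trig_polynomial.add)
next
  case (mult f g)
  then show ?case by (intro trig_polynomial_mult)
qed

lemma torus_map_fundamental_box:
  assumes "A > 0"
  obtains y where "\<forall>b\<in>Basis. \<bar>y \<bullet> b\<bar> \<le> A" "torus_map A x = torus_map A y"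
proof
  \<comment> \<open>The number of periods to remove: the integer for which
    \<open>x \<bullet> b - 2 * A * k b\<close> lies in \<open>[-A, A)\<close>.\<close>
  define k where "k b = \<lfloor>(x \<bullet> b + A) / (2 * A)\<rfloor>" for b
  define y where "y = (\<Sum>b\<in>Basis. (x \<bullet> b - 2 * A * k b) *\<^sub>R b)"
  have y: "y \<bullet> b = x \<bullet> b - 2 * A * k b" if "b \<in> Basis" for b
    using that by (simp add: y_def inner_sum_left inner_Basis if_distrib cong: if_cong)
  have "\<bar>y \<bullet> b\<bar> \<le> A" if "b \<in> Basis" for b
  proof -
    have "k b \<le> (x \<bullet> b + A) / (2 * A)" "(x \<bullet> b + A) / (2 * A) \<le> k b + 1"
      unfolding k_def by linarith+
    then have "k b * (2 * A) \<le> x \<bullet> b + A" "x \<bullet> b + A \<le> (k b + 1) * (2 * A)"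
      using assms by (simp_all add: field_simps)
    then show ?thesis unfolding y[OF that] by (auto simp: algebra_simps)
  qed
  then show "\<forall>b\<in>Basis. \<bar>y \<bullet> b\<bar> \<le> A" by blast
  have "cos (pi / A * (x \<bullet> b)) = cos (pi / A * (y \<bullet> b)) \<and> sin (pi / A * (x \<bullet> b)) = sin (pi / A * (y \<bullet> b))"
    if "b \<in> Basis" for b
  proof -
    have "pi / A * (x \<bullet> b) = pi / A * (y \<bullet> b) + 2 * pi * k b"
      unfolding y[OF that] using assms by (simp add: field_simps)
    then show ?thesis using sin_cos_eq_iff by (metis mult.commute mult.left_commute)
  qed
  then show "torus_map A x = torus_map A y" by (simp add: torus_map_eq_iff)
qed

text \<open>A function that vanishes on the boundary of a box extends periodically, hence factors
  continuously through the torus, where Stone--Weierstrass applies. Periodicity of the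
  approximant is what makes its bound global.\<close>

lemma trig_polynomial_approximation:
  fixes f :: "'a::euclidean_space \<Rightarrow> real"
  assumes cont: "continuous_on UNIV f" and B: "\<And>x. \<bar>f x\<bar> \<le> B"
    and A: "A > 0" and zero: "\<And>x b. b \<in> Basis \<Longrightarrow> \<bar>x \<bullet> b\<bar> \<ge> A \<Longrightarrow> f x = 0"
    and e: "e > 0"
  obtains g where "trig_polynomial g"
    "\<And>x. (\<forall>b\<in>Basis. \<bar>x \<bullet> b\<bar> \<le> A) \<Longrightarrow> \<bar>f x - g x\<bar> \<le> e" "\<And>x. \<bar>g x\<bar> \<le> B + e"
proof -
  define K :: "'a set" where "K = cbox (- (A *\<^sub>R One)) (A *\<^sub>R One)"
  have K: "x \<in> K \<longleftrightarrow> (\<forall>b\<in>Basis. \<bar>x \<bullet> b\<bar> \<le> A)" for x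
    by (auto simp: K_def mem_box abs_le_iff minus_le_iff)
  have "compact K" by (simp add: K_def compact_cbox)
  \<comment> \<open>Points of the box with the same image differ in each coordinate by a multiple of
    \<open>2 * A\<close>. Where the multiple is nonzero, both coordinates are \<open>A\<close> in
    absolute value, so \<open>f\<close> is 0 at both points.\<close>
  have well: "f x = f y" if "x \<in> K" "y \<in> K" "torus_map A x = torus_map A y" for x y
  proof (cases "\<exists>b\<in>Basis. x \<bullet> b \<noteq> y \<bullet> b")
    case True
    then obtain b where b: "b \<in> Basis" "x \<bullet> b \<noteq> y \<bullet> b" by blast
    have "cos (pi / A * (x \<bullet> b)) = cos (pi / A * (y \<bullet> b))" "sin (pi / A * (x \<bullet> b)) = sin (pi / A * (y \<bullet> b))"
      using that(3) b(1) by (auto simp: torus_map_eq_iff)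
    then obtain k :: int where k: "pi / A * (x \<bullet> b) = pi / A * (y \<bullet> b) + 2 * pi * k"
      using sin_cos_eq_iff by metis
    then have "pi * (x \<bullet> b) = pi * (y \<bullet> b + 2 * A * k)" using A by (simp add: field_simps)
    then have k': "x \<bullet> b = y \<bullet> b + 2 * A * k" by simp
    have "k \<noteq> 0" using k' b(2) by auto
    then have "\<bar>real_of_int k\<bar> \<ge> 1" by linarith
    then have "\<bar>x \<bullet> b - y \<bullet> b\<bar> \<ge> 2 * A" using k' A by (simp add: abs_mult)
    moreover have "\<bar>x \<bullet> b\<bar> \<le> A" "\<bar>y \<bullet> b\<bar> \<le> A" using that b(1) K by auto
    ultimately have "\<bar>x \<bullet> b\<bar> \<ge> A" "\<bar>y \<bullet> b\<bar> \<ge> A" by linarith+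
    then show ?thesis using zero b(1) by metis
  next
    case False
    then show ?thesis by (metis euclidean_eq_iff)
  qed
  define F where "F z = f (SOME x. x \<in> K \<and> torus_map A x = z)" for z
  have F: "F (torus_map A x) = f x" if "x \<in> K" for x
  proof -
    have "(SOME y. y \<in> K \<and> torus_map A y = torus_map A x) \<in> K \<and>
        torus_map A (SOME y. y \<in> K \<and> torus_map A y = torus_map A x) = torus_map A x"
      by (rule someI[of "\<lambda>y. y \<in> K \<and> torus_map A y = torus_map A x" x]) (use that in auto)
    then show ?thesis unfolding F_def using well that by blast
  qed
  \<comment> \<open>A continuous map on a compact space is a quotient map onto its Hausdorff image:
    the preimage of a closed set under \<open>F\<close> is the image of a compact subset of
    \<open>K\<close>, hence closed.\<close>
  have "continuous_on (torus_map A ` K) F"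
    unfolding continuous_on_closed_invariant
  proof (intro allI impI)
    fix C :: "real set" assume C: "closed C"
    have "closed (f -` C)" by (intro continuous_closed_vimage C) (use cont in \<open>auto simp: continuous_on_eq_continuous_at\<close>)
    then have "compact (K \<inter> f -` C)" by (intro compact_Int_closed \<open>compact K\<close>)
    then have "closed (torus_map A ` (K \<inter> f -` C))"
      by (intro compact_imp_closed compact_continuous_image continuous_on_torus_map)
    moreover have "torus_map A ` (K \<inter> f -` C) \<inter> torus_map A ` K = F -` C \<inter> torus_map A ` K"
      using F by auto
    ultimately show "\<exists>D. closed D \<and> D \<inter> torus_map A ` K = F -` C \<inter> torus_map A ` K" by blast
  qed
  moreover have "compact (torus_map A ` K)"
    by (intro compact_continuous_image continuous_on_torus_map \<open>compact K\<close>)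
  ultimately obtain g where g: "real_polynomial_function g"
    "\<And>z. z \<in> torus_map A ` K \<Longrightarrow> \<bar>F z - g z\<bar> < e"
    using Stone_Weierstrass_real_polynomial_function e by metis
  show thesis
  proof
    show "trig_polynomial (\<lambda>x. g (torus_map A x))" by (rule trig_polynomial_torus_map[OF g(1)])
    have close: "\<bar>f x - g (torus_map A x)\<bar> < e" if "x \<in> K" for x
      using g(2)[of "torus_map A x"] F that by auto
    then show "\<bar>f x - g (torus_map A x)\<bar> \<le> e" if "\<forall>b\<in>Basis. \<bar>x \<bullet> b\<bar> \<le> A" for x
      using that K less_imp_le by blast
    show "\<bar>g (torus_map A x)\<bar> \<le> B + e" for x
    proof -
      obtain y where "y \<in> K" "torus_map A x = torus_map A y"
        using torus_map_fundamental_box[OF A] unfolding K by metis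
      then show ?thesis using close[of y] B[of y] by (simp add: abs_le_iff abs_less_iff)
    qed
  qed
qed

subsection \<open>Multivariate normal laws\<close>

lemma symmetric_inner_matrix_vector:
  fixes S :: "real ^ 'q ^ 'q"
  assumes "transpose S = S"
  shows "x \<bullet> (S *v y) = y \<bullet> (S *v x)"
proof -
  have "x \<bullet> (S *v y) = (S *v x) \<bullet> y"
    by (metis assms dot_lmul_matrix transpose_matrix_vector)
  then show ?thesis by (simp add: inner_commute)
qed

text \<open>Cholesky elimination: each step removes one row and column from a positive semidefinite
  matrix. A vanishing pivot forces the whole column to vanish.\<close>

lemma psd_sum_of_squares:
  fixes S :: "real ^ 'q ^ 'q"
  assumes "finite J" "transpose S = S" "\<And>t. 0 \<le> t \<bullet> (S *v t)" "\<And>i. i \<notin> J \<Longrightarrow> column i S = 0"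
  shows "\<exists>a :: 'q \<Rightarrow> real ^ 'q. \<forall>t. t \<bullet> (S *v t) = (\<Sum>j\<in>J. (a j \<bullet> t)\<^sup>2)"
  using assms
proof (induction J arbitrary: S rule: finite_induct)
  case empty
  then have "S $ i $ j = 0" for i j by (metis column_def empty_iff vec_lambda_beta zero_index)
  then have "S = 0" by (simp add: vec_eq_iff)
  then show ?case by simp
next
  case (insert j J)
  define w where "w = column j S"
  define s where "s = w $ j"
  have w: "S *v axis j 1 = w" by (simp add: w_def matrix_vector_mult_basis)
  \<comment> \<open>Along the direction \<open>axis j 1\<close> the form is a polynomial in
    \<open>c\<close> with leading coefficient the pivot \<open>s\<close>. Both cases of the
    elimination exploit its nonnegativity.\<close>
  have expand: "(t + c *\<^sub>R axis j 1) \<bullet> (S *v (t + c *\<^sub>R axis j 1)) = t \<bullet> (S *v t) + 2 * c * (w \<bullet> t) + c\<^sup>2 * s" for t c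
  proof -
    have "axis j 1 \<bullet> (S *v t) = w \<bullet> t"
      using symmetric_inner_matrix_vector[OF insert.prems(1), of "axis j 1" t] w by (simp add: inner_commute)
    moreover have "axis j 1 \<bullet> w = s" by (simp add: s_def inner_axis' )
    ultimately show ?thesis
      by (simp add: matrix_vector_right_distrib matrix_vector_mult_scaleR w inner_add_left inner_add_right
          inner_commute[of t w] power2_eq_square algebra_simps)
  qed
  have s: "s \<ge> 0"
    using insert.prems(2)[of "axis j 1"] w by (simp add: s_def inner_axis')
  show ?case
  proof (cases "s = 0")
    case True
    have "w \<bullet> t = 0" for t
    proof (rule ccontr)
      assume nz: "w \<bullet> t \<noteq> 0"
      \<comment> \<open>With pivot 0 the polynomial in \<open>c\<close> is affine with slope
        \<open>2 * (w \<bullet> t)\<close>; this \<open>c\<close> gives it the value -1.\<close>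
      define c where "c = - (t \<bullet> (S *v t) + 1) / (2 * (w \<bullet> t))"
      have "2 * c * (w \<bullet> t) = - (t \<bullet> (S *v t) + 1)" using nz by (simp add: c_def)
      then show False using insert.prems(2)[of "t + c *\<^sub>R axis j 1"] True unfolding expand by simp
    qed
    then have "w = 0" by (metis inner_eq_zero_iff)
    then have "\<And>i. i \<notin> J \<Longrightarrow> column i S = 0" using insert.prems(3) w_def by (metis insert_iff)
    then obtain a where a: "\<forall>t. t \<bullet> (S *v t) = (\<Sum>j\<in>J. (a j \<bullet> t)\<^sup>2)" using insert.IH insert.prems by blast
    have "(\<Sum>i\<in>insert j J. ((a(j := 0)) i \<bullet> t)\<^sup>2) = (\<Sum>i\<in>J. (a i \<bullet> t)\<^sup>2)" for t
      using insert.hyps by (simp, intro sum.cong) auto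
    then show ?thesis using a by metis
  next
    case False
    with s have s: "s > 0" by simp
    \<comment> \<open>The Schur complement of the pivot: subtracting the rank one matrix with
      entries \<open>w $ i * w $ k / s\<close> clears row and column \<open>j\<close>.\<close>
    define S' :: "real ^ 'q ^ 'q" where "S' = (\<chi> i k. S $ i $ k - w $ i * w $ k / s)"
    have S't: "S' *v t = S *v t - ((w \<bullet> t) / s) *\<^sub>R w" for t
      by (simp add: S'_def vec_eq_iff matrix_vector_mult_def inner_vec_def sum_subtractf left_diff_distrib
          sum_distrib_left sum_distrib_right sum_divide_distrib algebra_simps)
    have quad: "t \<bullet> (S' *v t) = t \<bullet> (S *v t) - (w \<bullet> t)\<^sup>2 / s" for t
      by (simp add: S't inner_diff_right inner_commute[of t w] power2_eq_square)
    have "0 \<le> t \<bullet> (S' *v t)" for t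
    proof -
      \<comment> \<open>The value \<open>c = - (w \<bullet> t) / s\<close> minimises the polynomial,
        and the minimum is the form of \<open>S'\<close> at \<open>t\<close>.\<close>
      have "0 \<le> t \<bullet> (S *v t) + 2 * (- (w \<bullet> t) / s) * (w \<bullet> t) + (- (w \<bullet> t) / s)\<^sup>2 * s"
        using insert.prems(2) unfolding expand[symmetric] by blast
      then show ?thesis unfolding quad using s by (simp add: power2_eq_square field_simps)
    qed
    moreover have sym: "S $ i $ k = S $ k $ i" for i k
      using insert.prems(1) by (metis transpose_def vec_lambda_beta)
    then have "transpose S' = S'" by (simp add: S'_def transpose_def vec_eq_iff mult.commute)
    moreover have "column i S' = 0" if "i \<notin> J" for i
    proof (cases "i = j")
      case True
      then show ?thesis using s by (simp add: S'_def column_def vec_eq_iff w_def s_def)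
    next
      case False
      then have "column i S = 0" using insert.prems(3) that by simp
      then have "S $ k $ i = 0" for k by (metis column_def vec_lambda_beta zero_index)
      moreover from this have "S $ i $ j = 0" using sym by metis
      ultimately show ?thesis by (simp add: S'_def column_def vec_eq_iff w_def)
    qed
    ultimately obtain a where a: "\<forall>t. t \<bullet> (S' *v t) = (\<Sum>j\<in>J. (a j \<bullet> t)\<^sup>2)" using insert.IH by blast
    \<comment> \<open>The new vector \<open>w / sqrt s\<close> restores the square that the
      elimination removed.\<close>
    have "(\<Sum>i\<in>insert j J. ((a(j := (1 / sqrt s) *\<^sub>R w)) i \<bullet> t)\<^sup>2) = (w \<bullet> t)\<^sup>2 / s + (\<Sum>i\<in>J. (a i \<bullet> t)\<^sup>2)" for t
    proof -
      have "(\<Sum>i\<in>J. ((a(j := (1 / sqrt s) *\<^sub>R w)) i \<bullet> t)\<^sup>2) = (\<Sum>i\<in>J. (a i \<bullet> t)\<^sup>2)"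
        using insert.hyps by (intro sum.cong) auto
      then show ?thesis using insert.hyps s by (simp add: power_mult_distrib power_divide)
    qed
    then have "\<forall>t. t \<bullet> (S *v t) = (\<Sum>i\<in>insert j J. ((a(j := (1 / sqrt s) *\<^sub>R w)) i \<bullet> t)\<^sup>2)"
      using a quad by (simp add: algebra_simps)
    then show ?thesis by blast
  qed
qed

section \<open>Existence and linear images of normal laws with given covariance\<close>

lemma (in prob_space) distr_linear_combination_normal:
  fixes Z :: "'i \<Rightarrow> 'a \<Rightarrow> real"
  assumes J: "finite J" and indep: "indep_vars (\<lambda>_. borel) Z J"
    and std: "\<And>j. j \<in> J \<Longrightarrow> distributed M lborel (Z j) std_normal_density"
  shows "distr M borel (\<lambda>\<omega>. \<Sum>j\<in>J. c j * Z j \<omega>) = normal_law 0 (\<Sum>j\<in>J. (c j)\<^sup>2)"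
proof -
  \<comment> \<open>Terms with coefficient 0 are dropped, because \<open>sum_indep_normal\<close>
    asks for positive standard deviations and a nonempty index set. If no term remains, the law is
    the point mass \<open>normal_law 0 0\<close>.\<close>
  define K where "K = {j\<in>J. c j \<noteq> 0}"
  have K: "finite K" "K \<subseteq> J" using J by (auto simp: K_def)
  have sumZ: "(\<Sum>j\<in>J. c j * Z j \<omega>) = (\<Sum>j\<in>K. c j * Z j \<omega>)" for \<omega>
    using J by (intro sum.mono_neutral_right) (auto simp: K_def)
  have sumc: "(\<Sum>j\<in>J. (c j)\<^sup>2) = (\<Sum>j\<in>K. \<bar>c j\<bar>\<^sup>2)"
    using J by (subst power2_abs, intro sum.mono_neutral_right) (auto simp: K_def)
  show ?thesis
  proof (cases "K = {}")
    case True
    have "distr M borel (\<lambda>\<omega>. 0) = return borel (0::real)"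
      by (rule distr_const) simp
    then show ?thesis unfolding sumZ sumc True normal_law_def by simp
  next
    case False
    have "indep_vars (\<lambda>_. borel) (\<lambda>j \<omega>. c j * Z j \<omega>) K"
      using indep_vars_compose2[OF indep_vars_subset[OF indep K(2)], of "\<lambda>j z. c j * z" "\<lambda>_. borel"] by simp
    then have "distributed M lborel (\<lambda>\<omega>. \<Sum>j\<in>K. c j * Z j \<omega>)
        (normal_density (\<Sum>j\<in>K. 0) (sqrt (\<Sum>j\<in>K. \<bar>c j\<bar>\<^sup>2)))"
    proof (rule sum_indep_normal[OF K(1) False])
      fix j assume "j \<in> K"
      then have "c j \<noteq> 0" "j \<in> J" by (auto simp: K_def)
      then show "0 < \<bar>c j\<bar>" by simp
      show "distributed M lborel (\<lambda>\<omega>. c j * Z j \<omega>) (normal_density 0 \<bar>c j\<bar>)"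
        using normal_density_affine[OF std[OF \<open>j \<in> J\<close>], of "c j" 0] \<open>c j \<noteq> 0\<close> by simp
    qed
    then have "distr M lborel (\<lambda>\<omega>. \<Sum>j\<in>K. c j * Z j \<omega>)
        = density lborel (\<lambda>x. ennreal (normal_density 0 (sqrt (\<Sum>j\<in>K. \<bar>c j\<bar>\<^sup>2)) x))"
      by (simp add: distributed_def)
    moreover have "(\<Sum>j\<in>K. \<bar>c j\<bar>\<^sup>2) \<noteq> 0"
      using K(1) False by (subst sum_nonneg_eq_0_iff) (auto simp: K_def)
    moreover have "distr M borel (\<lambda>\<omega>. \<Sum>j\<in>K. c j * Z j \<omega>) = distr M lborel (\<lambda>\<omega>. \<Sum>j\<in>K. c j * Z j \<omega>)"
      by (rule distr_cong) auto
    ultimately show ?thesis unfolding sumZ sumc normal_law_def by simp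
  qed
qed

text \<open>The joint law of all coordinates is the product measure itself and the marginals are its
  factors, which is the characterisation of independence by joint laws.\<close>

lemma indep_vars_PiM_coordinates:
  assumes "\<And>i. prob_space (N i)" "I \<noteq> {}"
  shows "prob_space.indep_vars (PiM I N) N (\<lambda>i z. z i) I"
proof -
  interpret P: prob_space "PiM I N" by (rule prob_space_PiM) (rule assms)
  have "distr (PiM I N) (PiM I N) (\<lambda>x. \<lambda>i\<in>I. x i) = distr (PiM I N) (PiM I N) (\<lambda>x. x)"
    by (rule distr_cong) (auto simp: space_PiM PiE_restrict)
  also have "\<dots> = PiM I N" by (rule distr_id)
  also have "\<dots> = PiM I (\<lambda>i. distr (PiM I N) (N i) (\<lambda>z. z i))"
    by (intro PiM_cong refl distr_PiM_component[symmetric] assms)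
  finally show ?thesis
    using assms(2) by (subst P.indep_vars_iff_distr_eq_PiM') auto
qed

text \<open>The form is a sum of squares \<open>(a j \<bullet> t)\<^sup>2\<close>, so the sum of
  \<open>z j *\<^sub>R a j\<close> with independent standard normal \<open>z j\<close> has the form
  as variance in direction \<open>t\<close>. No matrix is inverted, so \<open>S\<close> may be
  singular.\<close>

theorem normal_law_exists:
  fixes S :: "real ^ 'q ^ 'q"
  assumes S: "transpose S = S" "\<And>t. 0 \<le> t \<bullet> (S *v t)"
  shows "\<exists>N. is_normal_law N 0 S"
proof -
  have "\<exists>a :: 'q \<Rightarrow> real ^ 'q. \<forall>t. t \<bullet> (S *v t) = (\<Sum>j\<in>UNIV. (a j \<bullet> t)\<^sup>2)"
    by (rule psd_sum_of_squares[OF finite S]) auto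
  then obtain a :: "'q \<Rightarrow> real ^ 'q" where a: "\<And>t. t \<bullet> (S *v t) = (\<Sum>j\<in>UNIV. (a j \<bullet> t)\<^sup>2)"
    by blast
  define P where "P = PiM (UNIV :: 'q set) (\<lambda>_. std_normal_distribution)"
  have std: "prob_space std_normal_distribution" by (rule prob_space_normal_density) simp
  interpret P: prob_space P unfolding P_def by (rule prob_space_PiM) (rule std)
  have comp: "distr P std_normal_distribution (\<lambda>z. z j) = std_normal_distribution" for j
    unfolding P_def by (rule distr_PiM_component) (use std in auto)
  have [measurable]: "(\<lambda>z. z j) \<in> borel_measurable P" for j
  proof -
    have "(\<lambda>z. z j) \<in> measurable P std_normal_distribution" unfolding P_def by simp
    then show ?thesis by simp
  qed
  have indep: "P.indep_vars (\<lambda>_. borel) (\<lambda>j z. z j) UNIV"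
  proof -
    have "P.indep_vars (\<lambda>_. std_normal_distribution) (\<lambda>j z. z j) UNIV"
      unfolding P_def by (rule indep_vars_PiM_coordinates) (use std in auto)
    then show ?thesis unfolding P.indep_vars_def by simp
  qed
  have distributed: "distributed P lborel (\<lambda>z. z j) std_normal_density" for j
  proof -
    have "distr P lborel (\<lambda>z. z j) = distr P std_normal_distribution (\<lambda>z. z j)"
      by (rule distr_cong) auto
    then show ?thesis unfolding distributed_def comp by simp
  qed
  define f where "f z = (\<Sum>j\<in>UNIV. z j *\<^sub>R a j)" for z :: "'q \<Rightarrow> real"
  have [measurable]: "f \<in> borel_measurable P" unfolding f_def by measurable
  have "distr (distr P borel f) borel (\<lambda>x. t \<bullet> x) = normal_law (t \<bullet> 0) (t \<bullet> (S *v t))" for t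
  proof -
    have "distr (distr P borel f) borel (\<lambda>x. t \<bullet> x) = distr P borel (\<lambda>z. \<Sum>j\<in>UNIV. (a j \<bullet> t) * z j)"
      by (subst distr_distr) (auto simp: comp_def f_def inner_sum_right inner_commute mult.commute)
    also have "\<dots> = normal_law 0 (\<Sum>j\<in>UNIV. (a j \<bullet> t)\<^sup>2)"
      by (rule P.distr_linear_combination_normal[OF _ indep distributed]) simp
    finally show ?thesis by (simp add: a)
  qed
  then have "is_normal_law (distr P borel f) 0 S"
    unfolding is_normal_law_def using S by (auto intro: P.prob_space_distr)
  then show ?thesis ..
qed

text \<open>The functional \<open>t\<close> of the image is the functional
  \<open>transpose A *v t\<close> of the original vector; mean and variance transform
  accordingly.\<close>

lemma is_normal_law_linear_image:
  fixes A S :: "real ^ 'q ^ 'q"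
  assumes N: "is_normal_law N \<mu> S"
  shows "is_normal_law (distr N borel ((*v) A)) (A *v \<mu>) (A ** S ** transpose A)"
proof -
  interpret N: prob_space N using N by (simp add: is_normal_law_def)
  have [measurable_cong]: "sets N = sets borel" using N by (simp add: is_normal_law_def)
  have A[measurable]: "(*v) A \<in> borel_measurable borel"
    by (intro borel_measurable_continuous_onI linear_continuous_on matrix_vector_mul_bounded_linear)
  have adj: "t \<bullet> (A *v x) = (transpose A *v t) \<bullet> x" for t x
    by (simp add: dot_lmul_matrix transpose_matrix_vector)
  have quad: "t \<bullet> ((A ** S ** transpose A) *v t) = (transpose A *v t) \<bullet> (S *v (transpose A *v t))" for t
    by (simp add: adj matrix_vector_mul_assoc[symmetric])
  have "transpose (A ** S ** transpose A) = A ** S ** transpose A"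
    using N by (simp add: is_normal_law_def matrix_transpose_mul matrix_mul_assoc)
  moreover have "distr (distr N borel ((*v) A)) borel (\<lambda>x. t \<bullet> x) =
      normal_law (t \<bullet> (A *v \<mu>)) (t \<bullet> ((A ** S ** transpose A) *v t))" for t
  proof -
    have "distr (distr N borel ((*v) A)) borel (\<lambda>x. t \<bullet> x) = distr N borel (\<lambda>x. (transpose A *v t) \<bullet> x)"
      by (subst distr_distr) (auto simp: comp_def adj)
    then show ?thesis using N unfolding quad adj by (simp add: is_normal_law_def)
  qed
  ultimately show ?thesis
    using N A unfolding is_normal_law_def quad by (auto intro!: N.prob_space_distr)
qed

subsection \<open>Weak convergence of random vectors\<close>

text \<open>Only large \<open>n\<close> are constrained. For random vectors on a probability space
  this loses nothing, since each single one has small tails (\<open>prob_norm_tail\<close>).\<close>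

definition tight_rv :: "'w measure \<Rightarrow> (nat \<Rightarrow> 'w \<Rightarrow> 'b::euclidean_space) \<Rightarrow> bool" where
  "tight_rv M Y \<longleftrightarrow>
     (\<forall>e>0. \<exists>A>0. \<forall>\<^sub>F n in sequentially. measure M {\<omega>\<in>space M. norm (Y n \<omega>) > A} < e)"

lemma weak_conv_rv_measurable: "weak_conv_rv M Y N \<Longrightarrow> Y n \<in> borel_measurable M"
  by (simp add: weak_conv_rv_def)

lemma conv_in_prob_measurable: "conv_in_prob M Y L \<Longrightarrow> Y n \<in> borel_measurable M"
  by (simp add: conv_in_prob_def)

lemma conv_in_probD:
  "conv_in_prob M Y L \<Longrightarrow> e > 0 \<Longrightarrow> (\<lambda>n. measure M {\<omega>\<in>space M. dist (Y n \<omega>) L > e}) \<longlonglongrightarrow> 0"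
  by (simp add: conv_in_prob_def)

lemma prob_norm_tail:
  fixes Y :: "'w \<Rightarrow> 'b::euclidean_space"
  assumes "prob_space M" and [measurable]: "Y \<in> borel_measurable M" and e: "e > 0"
  obtains A where "A > 0" "measure M {\<omega>\<in>space M. norm (Y \<omega>) > A} < e"
proof -
  interpret prob_space M by fact
  have "(\<lambda>n. prob {\<omega>\<in>space M. norm (Y \<omega>) > real n}) \<longlonglongrightarrow> prob (\<Inter>n. {\<omega>\<in>space M. norm (Y \<omega>) > real n})"
  proof (rule finite_Lim_measure_decseq)
    show "range (\<lambda>n. {\<omega>\<in>space M. norm (Y \<omega>) > real n}) \<subseteq> events" by auto
    show "decseq (\<lambda>n. {\<omega>\<in>space M. norm (Y \<omega>) > real n})"
      by (rule antimonoI) (use le_less_trans of_nat_mono in blast)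
  qed
  also have "(\<Inter>n. {\<omega>\<in>space M. norm (Y \<omega>) > real n}) = {}"
  proof -
    have "\<exists>n. norm (Y \<omega>) \<le> real n" for \<omega> by (rule real_arch_simple)
    then show ?thesis by (fastforce simp: not_less[symmetric])
  qed
  finally have "\<forall>\<^sub>F n in sequentially. prob {\<omega>\<in>space M. norm (Y \<omega>) > real n} < e"
    using e by (intro order_tendstoD) auto
  then have "\<forall>\<^sub>F n in sequentially. prob {\<omega>\<in>space M. norm (Y \<omega>) > real n} < e \<and> n > 0"
    using eventually_gt_at_top by (rule eventually_conj)
  then obtain n where "prob {\<omega>\<in>space M. norm (Y \<omega>) > real n} < e" "n > 0"
    unfolding eventually_sequentially by blast
  then show thesis by (intro that[of "real n"]) auto
qed

lemma (in prob_space) integrable_bounded_continuous: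
  fixes f :: "'b::euclidean_space \<Rightarrow> real"
  assumes "continuous_on UNIV f" "\<And>x. \<bar>f x\<bar> \<le> B" "Y \<in> borel_measurable M"
  shows "integrable M (\<lambda>\<omega>. f (Y \<omega>))"
proof (rule integrable_const_bound[where B = B])
  have [measurable]: "f \<in> borel_measurable borel" by (rule borel_measurable_continuous_onI) fact
  show "(\<lambda>\<omega>. f (Y \<omega>)) \<in> borel_measurable M" using assms(3) by measurable
qed (use assms(2) in auto)

lemma weak_conv_rv_iff_expectation:
  "weak_conv_rv M Y N \<longleftrightarrow> (\<forall>n. Y n \<in> borel_measurable M) \<and>
     (\<forall>f::'b::euclidean_space \<Rightarrow> real. continuous_on UNIV f \<and> bounded (range f) \<longrightarrow>
        (\<lambda>n. \<integral>\<omega>. f (Y n \<omega>) \<partial>M) \<longlonglongrightarrow> (\<integral>x. f x \<partial>N))"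
  unfolding weak_conv_rv_def
  by (intro conj_cong refl all_cong)
     (auto simp: integral_distr borel_measurable_continuous_onI)

text \<open>On the ball of radius \<open>A\<close> the integrands differ by at most
  \<open>e\<close>; outside they differ by at most \<open>B + C\<close>, on an event of probability
  at most \<open>d\<close>. It serves the sequence and, with \<open>Y\<close> the identity, the
  limit law.\<close>

lemma (in prob_space) expectation_approx_off_tail:
  fixes f g :: "'b::euclidean_space \<Rightarrow> real" and Y :: "'a \<Rightarrow> 'b"
  assumes [measurable]: "Y \<in> borel_measurable M"
    and f: "continuous_on UNIV f" "\<And>x. \<bar>f x\<bar> \<le> B"
    and g: "continuous_on UNIV g" "\<And>x. \<bar>g x\<bar> \<le> C"
    and close: "\<And>x. norm x \<le> A \<Longrightarrow> \<bar>f x - g x\<bar> \<le> e"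
    and e: "0 \<le> e" and tail: "prob {\<omega>\<in>space M. norm (Y \<omega>) > A} \<le> d"
  shows "\<bar>expectation (\<lambda>\<omega>. f (Y \<omega>)) - expectation (\<lambda>\<omega>. g (Y \<omega>))\<bar> \<le> e + (B + C) * d"
proof -
  let ?T = "{\<omega>\<in>space M. norm (Y \<omega>) > A}"
  have int: "integrable M (\<lambda>\<omega>. f (Y \<omega>))" "integrable M (\<lambda>\<omega>. g (Y \<omega>))"
    using integrable_bounded_continuous f g assms(1) by blast+
  have BC: "B + C \<ge> 0" using f(2)[of 0] g(2)[of 0] by linarith
  have "\<bar>expectation (\<lambda>\<omega>. f (Y \<omega>)) - expectation (\<lambda>\<omega>. g (Y \<omega>))\<bar> = \<bar>expectation (\<lambda>\<omega>. f (Y \<omega>) - g (Y \<omega>))\<bar>"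
    using int by simp
  also have "\<dots> \<le> expectation (\<lambda>\<omega>. \<bar>f (Y \<omega>) - g (Y \<omega>)\<bar>)"
    by (rule integral_abs_bound)
  also have "\<dots> \<le> expectation (\<lambda>\<omega>. e + (B + C) * indicator ?T \<omega>)"
  proof (rule integral_mono)
    show "integrable M (\<lambda>\<omega>. \<bar>f (Y \<omega>) - g (Y \<omega>)\<bar>)" using int by simp
    have "?T \<in> events" by measurable
    then show "integrable M (\<lambda>\<omega>. e + (B + C) * indicator ?T \<omega>)"
      by (intro Bochner_Integration.integrable_add integrable_const integrable_mult_right
          integrable_real_indicator) (auto simp: less_top[symmetric])
    fix \<omega> assume "\<omega> \<in> space M"
    then show "\<bar>f (Y \<omega>) - g (Y \<omega>)\<bar> \<le> e + (B + C) * indicator ?T \<omega>"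
      using close[of "Y \<omega>"] f(2)[of "Y \<omega>"] g(2)[of "Y \<omega>"] e
      by (auto simp: indicator_def not_less abs_le_iff)
  qed
  also have "\<dots> = e + (B + C) * prob ?T"
  proof -
    have "?T \<in> events" by measurable
    then have "integrable M (\<lambda>\<omega>. (B + C) * indicator ?T \<omega>)"
      by (intro integrable_mult_right integrable_real_indicator) (auto simp: less_top[symmetric])
    then show ?thesis using \<open>?T \<in> events\<close> by (subst Bochner_Integration.integral_add) (simp_all add: prob_space)
  qed
  also have "\<dots> \<le> e + (B + C) * d" using tail BC by (simp add: mult_left_mono)
  finally show ?thesis .
qed

lemma trig_polynomial_expectation_tendsto:
  fixes g :: "'b::euclidean_space \<Rightarrow> real"
  assumes "prob_space M" "prob_space N" "sets N = sets borel"
    and meas: "\<And>n. Y n \<in> borel_measurable M"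
    and conv: "\<And>t b. (\<lambda>n. \<integral>\<omega>. cos (t \<bullet> Y n \<omega> + b) \<partial>M) \<longlonglongrightarrow> (\<integral>x. cos (t \<bullet> x + b) \<partial>N)"
    and "trig_polynomial g"
  shows "(\<lambda>n. \<integral>\<omega>. g (Y n \<omega>) \<partial>M) \<longlonglongrightarrow> (\<integral>x. g x \<partial>N)"
proof -
  interpret M: prob_space M by fact
  interpret N: prob_space N by fact
  have [measurable]: "(\<lambda>x. x) \<in> borel_measurable N" using assms(3) by (simp add: measurable_ident_sets)
  have int: "integrable M (\<lambda>\<omega>. f (Y n \<omega>))" "integrable N f" if "trig_polynomial f" for f :: "'b \<Rightarrow> real" and n
  proof -
    obtain B where f: "continuous_on UNIV f" "\<And>x. \<bar>f x\<bar> \<le> B"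
      using trig_polynomial_bounded_continuous[OF \<open>trig_polynomial f\<close>] by blast
    show "integrable M (\<lambda>\<omega>. f (Y n \<omega>))" "integrable N f"
      by (rule M.integrable_bounded_continuous[OF f meas])
         (rule N.integrable_bounded_continuous[OF f \<open>(\<lambda>x. x) \<in> borel_measurable N\<close>])
  qed
  from assms(6) show ?thesis
  proof induction
    case (cos t b)
    then show ?case by (rule conv)
  next
    case (add f g)
    then show ?case using int by (simp add: tendsto_add)
  next
    case (scale f c)
    then show ?case using int by (simp add: tendsto_mult)
  qed
qed

lemma weak_conv_rvI_trig:
  fixes Y :: "nat \<Rightarrow> 'w \<Rightarrow> 'b::euclidean_space"
  assumes "prob_space M" "prob_space N" "sets N = sets borel"
    and meas[measurable]: "\<And>n. Y n \<in> borel_measurable M"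
    and tight: "tight_rv M Y"
    and conv: "\<And>t b. (\<lambda>n. \<integral>\<omega>. cos (t \<bullet> Y n \<omega> + b) \<partial>M) \<longlonglongrightarrow> (\<integral>x. cos (t \<bullet> x + b) \<partial>N)"
  shows "weak_conv_rv M Y N"
  unfolding weak_conv_rv_iff_expectation
proof (intro conjI allI impI meas)
  interpret M: prob_space M by fact
  interpret N: prob_space N by fact
  have idN[measurable]: "(\<lambda>x. x) \<in> borel_measurable N" using assms(3) by (simp add: measurable_ident_sets)
  fix f :: "'b \<Rightarrow> real" assume f: "continuous_on UNIV f \<and> bounded (range f)"
  then obtain B where B: "\<And>x. \<bar>f x\<bar> \<le> B" by (auto simp: bounded_iff)
  have B0: "B \<ge> 0" using B[of 0] by linarith
  show "(\<lambda>n. \<integral>\<omega>. f (Y n \<omega>) \<partial>M) \<longlonglongrightarrow> (\<integral>x. f x \<partial>N)"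
  proof (rule LIMSEQ_I)
    fix r :: real assume r: "r > 0"
    \<comment> \<open>Makes the cost \<open>e + (2 * B + e) * e\<close> of replacing the test
      function at most \<open>r / 4\<close>. It is paid once for the sequence and once for the
      limit, and convergence for the approximant costs a third \<open>r / 4\<close>.\<close>
    define e where "e = min 1 (r / (4 * (2 * B + 2)))"
    have e: "e > 0" "e \<le> 1" "e * (2 * B + 2) \<le> r / 4"
    proof -
      show "e > 0" "e \<le> 1" using B0 r by (auto simp: e_def)
      have "e * (2 * B + 2) \<le> r / (4 * (2 * B + 2)) * (2 * B + 2)"
        using B0 by (intro mult_right_mono) (auto simp: e_def)
      also have "\<dots> = r / 4" using B0 by (simp add: field_simps)
      finally show "e * (2 * B + 2) \<le> r / 4" .
    qed
    have bound: "e + (B + (B + e)) * e \<le> r / 4"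
    proof -
      have "(B + (B + e)) * e \<le> (2 * B + 1) * e" using e by (intro mult_right_mono) auto
      then show ?thesis using e(3) by (simp add: algebra_simps)
    qed
    obtain A1 where A1: "A1 > 0" "\<forall>\<^sub>F n in sequentially. measure M {\<omega>\<in>space M. norm (Y n \<omega>) > A1} < e"
      using tight e unfolding tight_rv_def by blast
    obtain A2 where A2: "A2 > 0" "measure N {x\<in>space N. norm x > A2} < e"
      using prob_norm_tail[OF \<open>prob_space N\<close> idN e(1)] by blast
    define A where "A = max A1 A2"
    have tailM: "\<forall>\<^sub>F n in sequentially. measure M {\<omega>\<in>space M. norm (Y n \<omega>) > A} \<le> e"
      using A1(2)
    proof eventually_elim
      case (elim n)
      have "measure M {\<omega>\<in>space M. norm (Y n \<omega>) > A} \<le> measure M {\<omega>\<in>space M. norm (Y n \<omega>) > A1}"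
        by (rule M.finite_measure_mono) (auto simp: A_def)
      then show ?case using elim by simp
    qed
    have "measure N {x\<in>space N. norm x > A} \<le> measure N {x\<in>space N. norm x > A2}"
      by (rule N.finite_measure_mono) (auto simp: A_def)
    then have tailN: "measure N {x\<in>space N. norm x > A} \<le> e" using A2 by simp
    \<comment> \<open>Damping between the radii \<open>A\<close> and \<open>A + 1\<close> makes
      \<open>h\<close> vanish on and beyond the faces of the box of half-width \<open>A + 1\<close>,
      while it still equals \<open>f\<close> on the ball of radius \<open>A\<close>.\<close>
    define h where "h x = f x * max 0 (min 1 (A + 1 - norm x))" for x
    have "continuous_on UNIV h" unfolding h_def using f by (intro continuous_intros) auto
    moreover have "\<bar>h x\<bar> \<le> B" for x
    proof -
      have "\<bar>h x\<bar> \<le> \<bar>f x\<bar> * 1" unfolding h_def abs_mult by (intro mult_left_mono) auto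
      then show ?thesis using B[of x] by simp
    qed
    moreover have "h x = 0" if "b \<in> Basis" "\<bar>x \<bullet> b\<bar> \<ge> A + 1" for x b
      using Basis_le_norm[OF that(1), of x] that(2) by (simp add: h_def)
    moreover have "A + 1 > 0" using A1(1) by (simp add: A_def)
    ultimately obtain g where g: "trig_polynomial g"
      "\<And>x. (\<forall>b\<in>Basis. \<bar>x \<bullet> b\<bar> \<le> A + 1) \<Longrightarrow> \<bar>h x - g x\<bar> \<le> e" "\<And>x. \<bar>g x\<bar> \<le> B + e"
      using trig_polynomial_approximation[of h B "A + 1" e] e(1) by blast
    have close: "\<bar>f x - g x\<bar> \<le> e" if "norm x \<le> A" for x
    proof -
      have "\<forall>b\<in>Basis. \<bar>x \<bullet> b\<bar> \<le> A + 1" using Basis_le_norm[of _ x] that by fastforce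
      moreover have "h x = f x" using that by (simp add: h_def)
      ultimately show ?thesis using g(2)[of x] by simp
    qed
    have gcont: "continuous_on UNIV g" using trig_polynomial_bounded_continuous[OF g(1)] by blast
    have fcont: "continuous_on UNIV f" using f by blast
    have "\<bar>(\<integral>x. f x \<partial>N) - (\<integral>x. g x \<partial>N)\<bar> \<le> e + (B + (B + e)) * e"
      by (rule N.expectation_approx_off_tail[OF idN fcont B gcont g(3) close _ tailN]) (use e in auto)
    then have N: "\<bar>(\<integral>x. f x \<partial>N) - (\<integral>x. g x \<partial>N)\<bar> \<le> r / 4" using bound by simp
    have "(\<lambda>n. \<integral>\<omega>. g (Y n \<omega>) \<partial>M) \<longlonglongrightarrow> (\<integral>x. g x \<partial>N)"
      by (rule trig_polynomial_expectation_tendsto[OF assms(1-3) meas conv g(1)])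
    then have "\<forall>\<^sub>F n in sequentially. dist (\<integral>\<omega>. g (Y n \<omega>) \<partial>M) (\<integral>x. g x \<partial>N) < r / 4"
      by (rule tendstoD) (use r in auto)
    with tailM have "\<forall>\<^sub>F n in sequentially. norm ((\<integral>\<omega>. f (Y n \<omega>) \<partial>M) - (\<integral>x. f x \<partial>N)) < r"
    proof eventually_elim
      case (elim n)
      have "\<bar>(\<integral>\<omega>. f (Y n \<omega>) \<partial>M) - (\<integral>\<omega>. g (Y n \<omega>) \<partial>M)\<bar> \<le> e + (B + (B + e)) * e"
        by (rule M.expectation_approx_off_tail[OF meas fcont B gcont g(3) close _ elim(1)]) (use e in auto)
      then show ?case using N bound elim(2) r unfolding dist_real_def real_norm_def by linarith
    qed
    then show "\<exists>no. \<forall>n\<ge>no. norm ((\<integral>\<omega>. f (Y n \<omega>) \<partial>M) - (\<integral>x. f x \<partial>N)) < r"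
      by (simp add: eventually_sequentially)
  qed
qed

text \<open>A continuous ramp lies between the indicators of \<open>norm x > A + 1\<close> and
  \<open>norm x > A\<close>. Convergence of its expectations transfers the tail bound of the limit
  law to all large \<open>n\<close>.\<close>

lemma weak_conv_rv_imp_tight:
  fixes Y :: "nat \<Rightarrow> 'w \<Rightarrow> 'b::euclidean_space"
  assumes "prob_space M" "prob_space N" "sets N = sets borel" and conv: "weak_conv_rv M Y N"
  shows "tight_rv M Y"
  unfolding tight_rv_def
proof (intro allI impI)
  interpret M: prob_space M by fact
  interpret N: prob_space N by fact
  have idN[measurable]: "(\<lambda>x. x) \<in> borel_measurable N" using assms(3) by (simp add: measurable_ident_sets)
  have [measurable]: "\<And>n. Y n \<in> borel_measurable M" using conv by (rule weak_conv_rv_measurable)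
  fix e :: real assume "e > 0"
  obtain A where A: "A > 0" "measure N {x\<in>space N. norm x > A} < e"
    using prob_norm_tail[OF \<open>prob_space N\<close> idN \<open>e > 0\<close>] by blast
  define f where "f x = max 0 (min 1 (norm x - A))" for x :: 'b
  have f: "continuous_on UNIV f" "\<And>x. \<bar>f x\<bar> \<le> 1" unfolding f_def by (auto intro!: continuous_intros)
  have "(\<lambda>n. \<integral>\<omega>. f (Y n \<omega>) \<partial>M) \<longlonglongrightarrow> (\<integral>x. f x \<partial>N)"
    using conv f unfolding weak_conv_rv_iff_expectation by (auto simp: bounded_iff)
  moreover have "(\<integral>x. f x \<partial>N) < e"
  proof -
    have "{x\<in>space N. norm x > A} \<in> sets N" by measurable
    then have "(\<integral>x. f x \<partial>N) \<le> (\<integral>x. indicator {x\<in>space N. norm x > A} x \<partial>N)"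
      by (intro integral_mono N.integrable_bounded_continuous[OF f idN])
         (auto simp: f_def split: split_indicator intro!: integrable_real_indicator N.emeasure_finite simp: less_top[symmetric])
    then show ?thesis using A by simp
  qed
  ultimately have "\<forall>\<^sub>F n in sequentially. (\<integral>\<omega>. f (Y n \<omega>) \<partial>M) < e" by (rule order_tendstoD)
  then have "\<forall>\<^sub>F n in sequentially. measure M {\<omega>\<in>space M. norm (Y n \<omega>) > A + 1} < e"
  proof eventually_elim
    case (elim n)
    have "{\<omega>\<in>space M. norm (Y n \<omega>) > A + 1} \<in> sets M" by measurable
    then have "(\<integral>\<omega>. indicator {\<omega>\<in>space M. norm (Y n \<omega>) > A + 1} \<omega> \<partial>M) \<le> (\<integral>\<omega>. f (Y n \<omega>) \<partial>M)"
      by (intro integral_mono M.integrable_bounded_continuous[OF f])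
         (auto simp: f_def split: split_indicator intro!: integrable_real_indicator M.emeasure_finite simp: less_top[symmetric])
    then show ?case using elim by simp
  qed
  then show "\<exists>A>0. \<forall>\<^sub>F n in sequentially. measure M {\<omega>\<in>space M. norm (Y n \<omega>) > A} < e"
    using A(1) by (intro exI[of _ "A + 1"]) auto
qed

lemma weak_conv_rv_continuous_image:
  fixes Y :: "nat \<Rightarrow> 'w \<Rightarrow> 'a::euclidean_space" and g :: "'a \<Rightarrow> 'b::euclidean_space"
  assumes "prob_space N" "sets N = sets borel" and conv: "weak_conv_rv M Y N"
    and g: "continuous_on UNIV g"
  shows "weak_conv_rv M (\<lambda>n \<omega>. g (Y n \<omega>)) (distr N borel g)"
  unfolding weak_conv_rv_iff_expectation
proof (intro conjI allI impI)
  have [measurable]: "\<And>n. Y n \<in> borel_measurable M" using conv by (rule weak_conv_rv_measurable)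
  have [measurable]: "g \<in> borel_measurable borel" using g by (rule borel_measurable_continuous_onI)
  show "(\<lambda>\<omega>. g (Y n \<omega>)) \<in> borel_measurable M" for n by measurable
  fix f :: "'b \<Rightarrow> real" assume f: "continuous_on UNIV f \<and> bounded (range f)"
  then have [measurable]: "f \<in> borel_measurable borel" by (auto intro: borel_measurable_continuous_onI)
  have "continuous_on UNIV (\<lambda>x. f (g x))"
    by (rule continuous_on_compose2[of UNIV f]) (use f g in auto)
  moreover have "bounded (range (\<lambda>x. f (g x)))"
    by (rule bounded_subset[of "range f"]) (use f in auto)
  ultimately have "(\<lambda>n. \<integral>\<omega>. f (g (Y n \<omega>)) \<partial>M) \<longlonglongrightarrow> (\<integral>x. f (g x) \<partial>N)"
    using conv unfolding weak_conv_rv_iff_expectation by blast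
  moreover have "g \<in> borel_measurable N" using assms(2) by (simp cong: measurable_cong_sets)
  ultimately show "(\<lambda>n. \<integral>\<omega>. f (g (Y n \<omega>)) \<partial>M) \<longlonglongrightarrow> (\<integral>x. f x \<partial>distr N borel g)"
    by (subst integral_distr) auto
qed

lemma abs_cos_diff_le: "\<bar>cos x - cos y\<bar> \<le> \<bar>x - y\<bar>" for x y :: real
proof -
  have "\<bar>cos x - cos y\<bar> = 2 * \<bar>sin ((x + y) / 2)\<bar> * \<bar>sin ((y - x) / 2)\<bar>"
    by (simp add: cos_diff_cos abs_mult)
  also have "\<dots> \<le> 2 * 1 * \<bar>(y - x) / 2\<bar>"
    by (intro mult_mono abs_sin_x_le_abs_x) auto
  finally show ?thesis by simp
qed

text \<open>Cosines are bounded and Lipschitz, so a perturbation that tends to 0 in probability does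
  not change the limits of their expectations. Tightness survives with the radius enlarged by 1, and
  the cosine criterion applies to \<open>Z\<close>.\<close>

lemma weak_conv_rv_slutsky:
  fixes Y Z :: "nat \<Rightarrow> 'w \<Rightarrow> 'b::euclidean_space"
  assumes "prob_space M" "prob_space N" "sets N = sets borel"
    and conv: "weak_conv_rv M Y N" and diff: "conv_in_prob M (\<lambda>n \<omega>. Z n \<omega> - Y n \<omega>) 0"
  shows "weak_conv_rv M Z N"
proof -
  interpret M: prob_space M by fact
  have Y[measurable]: "\<And>n. Y n \<in> borel_measurable M" using conv by (rule weak_conv_rv_measurable)
  have D[measurable]: "\<And>n. (\<lambda>\<omega>. Z n \<omega> - Y n \<omega>) \<in> borel_measurable M" using diff by (rule conv_in_prob_measurable)
  have Z[measurable]: "Z n \<in> borel_measurable M" for n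
    using borel_measurable_add[OF D[of n] Y[of n]] unfolding diff_add_cancel .
  have small: "\<forall>\<^sub>F n in sequentially. M.prob {\<omega>\<in>space M. norm (Z n \<omega> - Y n \<omega>) > r} < e" if "r > 0" "e > 0" for r e
  proof -
    have "(\<lambda>n. M.prob {\<omega>\<in>space M. norm (Z n \<omega> - Y n \<omega>) > r}) \<longlonglongrightarrow> 0"
      using conv_in_probD[OF diff that(1)] unfolding dist_norm diff_zero .
    then show ?thesis using that(2) by (rule order_tendstoD)
  qed
  show ?thesis
  proof (rule weak_conv_rvI_trig[OF assms(1-3) Z])
    show "tight_rv M Z"
      unfolding tight_rv_def
    proof (intro allI impI)
      fix e :: real assume "e > 0"
      then obtain A where A: "A > 0" "\<forall>\<^sub>F n in sequentially. M.prob {\<omega>\<in>space M. norm (Y n \<omega>) > A} < e / 2"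
        using weak_conv_rv_imp_tight[OF assms(1-4)] unfolding tight_rv_def by (meson half_gt_zero)
      have "\<forall>\<^sub>F n in sequentially. M.prob {\<omega>\<in>space M. norm (Z n \<omega> - Y n \<omega>) > 1} < e / 2"
        using small[of 1 "e / 2"] \<open>e > 0\<close> by simp
      with A(2) have "\<forall>\<^sub>F n in sequentially. M.prob {\<omega>\<in>space M. norm (Z n \<omega>) > A + 1} < e"
      proof eventually_elim
        case (elim n)
        have "norm (Z n \<omega>) \<le> norm (Y n \<omega>) + norm (Z n \<omega> - Y n \<omega>)" for \<omega>
          using norm_triangle_ineq[of "Y n \<omega>" "Z n \<omega> - Y n \<omega>"] by simp
        then have "norm (Z n \<omega>) > A + 1 \<Longrightarrow> norm (Y n \<omega>) > A \<or> norm (Z n \<omega> - Y n \<omega>) > 1" for \<omega>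
          by (smt (verit, best))
        then have "{\<omega>\<in>space M. norm (Z n \<omega>) > A + 1} \<subseteq>
            {\<omega>\<in>space M. norm (Y n \<omega>) > A} \<union> {\<omega>\<in>space M. norm (Z n \<omega> - Y n \<omega>) > 1}"
          by auto
        then have "M.prob {\<omega>\<in>space M. norm (Z n \<omega>) > A + 1} \<le>
            M.prob ({\<omega>\<in>space M. norm (Y n \<omega>) > A} \<union> {\<omega>\<in>space M. norm (Z n \<omega> - Y n \<omega>) > 1})"
          by (intro M.finite_measure_mono) auto
        also have "\<dots> \<le> M.prob {\<omega>\<in>space M. norm (Y n \<omega>) > A} + M.prob {\<omega>\<in>space M. norm (Z n \<omega> - Y n \<omega>) > 1}"
          by (rule measure_Un_le) auto
        finally show ?case using elim by simp
      qed
      then show "\<exists>A>0. \<forall>\<^sub>F n in sequentially. M.prob {\<omega>\<in>space M. norm (Z n \<omega>) > A} < e"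
        using A(1) by (intro exI[of _ "A + 1"]) auto
    qed
    fix t :: 'b and b :: real
    have lim: "(\<lambda>n. \<integral>\<omega>. cos (t \<bullet> Y n \<omega> + b) \<partial>M) \<longlonglongrightarrow> (\<integral>x. cos (t \<bullet> x + b) \<partial>N)"
      using conv trig_polynomial_bounded_continuous[OF trig_polynomial.cos[of t b]]
      unfolding weak_conv_rv_iff_expectation by (auto simp: bounded_iff)
    have "(\<lambda>n. (\<integral>\<omega>. cos (t \<bullet> Z n \<omega> + b) \<partial>M) - (\<integral>\<omega>. cos (t \<bullet> Y n \<omega> + b) \<partial>M)) \<longlonglongrightarrow> 0"
    proof (rule LIMSEQ_I)
      fix r :: real assume "r > 0"
      \<comment> \<open>Off the exceptional event the integrand changes by at most
        \<open>norm t * d \<le> r / 2\<close>; on it by at most 2, with probability below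
        \<open>r / 4\<close>. The added 1 covers \<open>t = 0\<close>.\<close>
      define d where "d = r / (2 * (norm t + 1))"
      have d: "d > 0" "norm t * d \<le> r / 2" using \<open>r > 0\<close>
        by (auto simp: d_def field_simps add_pos_nonneg add_nonneg_pos)
      have "r / 4 > 0" using \<open>r > 0\<close> by simp
      have "\<forall>\<^sub>F n in sequentially. norm ((\<integral>\<omega>. cos (t \<bullet> Z n \<omega> + b) \<partial>M) - (\<integral>\<omega>. cos (t \<bullet> Y n \<omega> + b) \<partial>M) - 0) < r"
        using small[OF d(1) \<open>r / 4 > 0\<close>]
      proof eventually_elim
        case (elim n)
        let ?T = "{\<omega>\<in>space M. norm (Z n \<omega> - Y n \<omega>) > d}"
        have int: "integrable M (\<lambda>\<omega>. cos (t \<bullet> V \<omega> + b))" if "V \<in> borel_measurable M" for V :: "'w \<Rightarrow> 'b"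
          by (rule M.integrable_bounded_continuous[of "\<lambda>x. cos (t \<bullet> x + b)" 1])
             (use that in \<open>auto intro!: continuous_intros\<close>)
        have "\<bar>(\<integral>\<omega>. cos (t \<bullet> Z n \<omega> + b) \<partial>M) - (\<integral>\<omega>. cos (t \<bullet> Y n \<omega> + b) \<partial>M)\<bar>
            = \<bar>\<integral>\<omega>. cos (t \<bullet> Z n \<omega> + b) - cos (t \<bullet> Y n \<omega> + b) \<partial>M\<bar>"
          using int[OF Z[of n]] int[OF Y[of n]] by simp
        also have "\<dots> \<le> (\<integral>\<omega>. \<bar>cos (t \<bullet> Z n \<omega> + b) - cos (t \<bullet> Y n \<omega> + b)\<bar> \<partial>M)"
          by (rule integral_abs_bound)
        also have "\<dots> \<le> (\<integral>\<omega>. norm t * d + 2 * indicator ?T \<omega> \<partial>M)"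
        proof (rule integral_mono)
          show "integrable M (\<lambda>\<omega>. \<bar>cos (t \<bullet> Z n \<omega> + b) - cos (t \<bullet> Y n \<omega> + b)\<bar>)"
            using int[OF Z[of n]] int[OF Y[of n]] by simp
          have "?T \<in> M.events" by measurable
          then show "integrable M (\<lambda>\<omega>. norm t * d + 2 * indicator ?T \<omega>)"
            by (intro Bochner_Integration.integrable_add M.integrable_const integrable_mult_right
                integrable_real_indicator) (auto simp: less_top[symmetric])
          fix \<omega> assume "\<omega> \<in> space M"
          show "\<bar>cos (t \<bullet> Z n \<omega> + b) - cos (t \<bullet> Y n \<omega> + b)\<bar> \<le> norm t * d + 2 * indicator ?T \<omega>"
          proof (cases "\<omega> \<in> ?T")
            case True
            have "\<bar>cos (t \<bullet> Z n \<omega> + b) - cos (t \<bullet> Y n \<omega> + b)\<bar> \<le> 1 + 1"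
              by (intro order_trans[OF abs_triangle_ineq4] add_mono) auto
            moreover have "0 \<le> norm t * d" using d by simp
            ultimately show ?thesis using True by simp
          next
            case False
            have "\<bar>cos (t \<bullet> Z n \<omega> + b) - cos (t \<bullet> Y n \<omega> + b)\<bar> \<le> \<bar>(t \<bullet> Z n \<omega> + b) - (t \<bullet> Y n \<omega> + b)\<bar>"
              by (rule abs_cos_diff_le)
            also have "\<dots> = \<bar>t \<bullet> (Z n \<omega> - Y n \<omega>)\<bar>" by (simp add: inner_diff_right)
            also have "\<dots> \<le> norm t * norm (Z n \<omega> - Y n \<omega>)" by (rule Cauchy_Schwarz_ineq2)
            also have "\<dots> \<le> norm t * d" using False \<open>\<omega> \<in> space M\<close> by (auto intro!: mult_left_mono)
            finally show ?thesis using False by simp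
          qed
        qed
        also have "\<dots> = norm t * d + 2 * M.prob ?T"
        proof -
          have "?T \<in> M.events" by measurable
          then have "integrable M (\<lambda>\<omega>. 2 * indicator ?T \<omega> :: real)"
            by (intro integrable_mult_right integrable_real_indicator) (auto simp: less_top[symmetric])
          then show ?thesis using \<open>?T \<in> M.events\<close>
            by (subst Bochner_Integration.integral_add) (simp_all add: M.prob_space)
        qed
        also have "\<dots> < r" using d(2) elim by simp
        finally show ?case by simp
      qed
      then show "\<exists>no. \<forall>n\<ge>no. norm ((\<integral>\<omega>. cos (t \<bullet> Z n \<omega> + b) \<partial>M) - (\<integral>\<omega>. cos (t \<bullet> Y n \<omega> + b) \<partial>M) - 0) < r"
        by (simp add: eventually_sequentially)
    qed
    from tendsto_add[OF this lim] show "(\<lambda>n. \<integral>\<omega>. cos (t \<bullet> Z n \<omega> + b) \<partial>M) \<longlonglongrightarrow> (\<integral>x. cos (t \<bullet> x + b) \<partial>N)"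
      by simp
  qed
qed

subsection \<open>The multivariate central limit theorem\<close>

text \<open>The cross terms vanish, as \<open>X i\<close> is centred and independent of the sum of
  the others. Both uses of Chebyshev's inequality below, for tightness and for the law of large
  numbers, rest on this.\<close>

lemma (in prob_space) expectation_square_sum_indep:
  fixes X :: "'i \<Rightarrow> 'a \<Rightarrow> real"
  assumes "finite J" "indep_vars (\<lambda>_. borel) X J"
    and "\<And>i. i \<in> J \<Longrightarrow> integrable M (\<lambda>\<omega>. (X i \<omega>)\<^sup>2)"
    and "\<And>i. i \<in> J \<Longrightarrow> expectation (X i) = 0"
  shows "integrable M (\<lambda>\<omega>. (\<Sum>i\<in>J. X i \<omega>)\<^sup>2) \<and>
    expectation (\<lambda>\<omega>. (\<Sum>i\<in>J. X i \<omega>)\<^sup>2) = (\<Sum>i\<in>J. expectation (\<lambda>\<omega>. (X i \<omega>)\<^sup>2))"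
  using assms
proof (induction J rule: finite_induct)
  case empty
  then show ?case by simp
next
  case (insert i J)
  let ?S = "\<lambda>\<omega>. \<Sum>j\<in>J. X j \<omega>"
  have rv[measurable]: "random_variable borel (X j)" if "j \<in> insert i J" for j
    using insert.prems(1) that unfolding indep_vars_def2 by blast
  have IH: "integrable M (\<lambda>\<omega>. (?S \<omega>)\<^sup>2)" "expectation (\<lambda>\<omega>. (?S \<omega>)\<^sup>2) = (\<Sum>i\<in>J. expectation (\<lambda>\<omega>. (X i \<omega>)\<^sup>2))"
    using insert.IH[OF indep_vars_subset[OF insert.prems(1)]] insert.prems by auto
  have intX: "integrable M (X j)" if "j \<in> insert i J" for j
    using square_integrable_imp_integrable[OF rv[OF that]] insert.prems(2) that by auto
  have intS: "integrable M ?S" using intX by auto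
  have ind: "indep_var borel (X i) borel ?S"
    by (rule indep_vars_sum) (use insert in auto)
  have cross: "integrable M (\<lambda>\<omega>. X i \<omega> * ?S \<omega>)" "expectation (\<lambda>\<omega>. X i \<omega> * ?S \<omega>) = 0"
    using indep_var_integrable[OF ind intX intS] indep_var_lebesgue_integral[OF ind intX intS] insert.prems(3) by auto
  have split: "(\<Sum>j\<in>insert i J. X j \<omega>)\<^sup>2 = (X i \<omega>)\<^sup>2 + 2 * (X i \<omega> * ?S \<omega>) + (?S \<omega>)\<^sup>2" for \<omega>
    using insert.hyps by (simp add: power2_sum)
  have "integrable M (\<lambda>\<omega>. (X i \<omega>)\<^sup>2)" using insert.prems(2) by simp
  then show ?case
    unfolding split using IH cross insert.hyps by simp
qed

lemma (in prob_space) iid_expectation: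
  fixes V :: "nat \<Rightarrow> 'a \<Rightarrow> 'b::topological_space" and f :: "'b \<Rightarrow> real"
  assumes "random_variable borel (V i)" "random_variable borel (V 0)"
    and "distr M borel (V i) = distr M borel (V 0)" and "f \<in> borel_measurable borel"
  shows "integrable M (\<lambda>\<omega>. f (V i \<omega>)) \<longleftrightarrow> integrable M (\<lambda>\<omega>. f (V 0 \<omega>))"
    and "expectation (\<lambda>\<omega>. f (V i \<omega>)) = expectation (\<lambda>\<omega>. f (V 0 \<omega>))"
  using integrable_distr_eq[OF assms(1,4)] integrable_distr_eq[OF assms(2,4)]
    integral_distr[OF assms(1,4)] integral_distr[OF assms(2,4)] assms(3) by simp_all

lemma std_normal_scale:
  assumes "v > 0"
  shows "distr std_normal_distribution borel (\<lambda>z. sqrt v * z) = normal_law 0 v"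
proof -
  interpret prob_space std_normal_distribution by (rule prob_space_normal_density) simp
  have "distr std_normal_distribution lborel (\<lambda>z. z) = std_normal_distribution"
    by (rule distr_id2) simp
  then have "distributed std_normal_distribution lborel (\<lambda>z. z) std_normal_density"
    by (simp add: distributed_def)
  from normal_density_affine[OF this, of "sqrt v" 0]
  have "distributed std_normal_distribution lborel (\<lambda>z. sqrt v * z) (normal_density 0 (sqrt v))"
    using assms by simp
  then have "distr std_normal_distribution lborel (\<lambda>z. sqrt v * z) = density lborel (\<lambda>x. ennreal (normal_density 0 (sqrt v) x))"
    by (simp add: distributed_def)
  moreover have "distr std_normal_distribution borel (\<lambda>z. sqrt v * z) = distr std_normal_distribution lborel (\<lambda>z. sqrt v * z)"
    by (rule distr_cong) auto
  ultimately show ?thesis using assms by (simp add: normal_law_def)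
qed

lemma (in prob_space) clt_bounded_continuous:
  fixes X :: "nat \<Rightarrow> 'a \<Rightarrow> real" and f :: "real \<Rightarrow> real"
  assumes indep: "indep_vars (\<lambda>_. borel) X UNIV"
    and iid: "\<And>i. distr M borel (X i) = distr M borel (X 0)"
    and mean: "expectation (X 0) = 0"
    and sq: "integrable M (\<lambda>\<omega>. (X 0 \<omega>)\<^sup>2)" and var: "expectation (\<lambda>\<omega>. (X 0 \<omega>)\<^sup>2) = v"
    and f: "continuous_on UNIV f" "\<And>x. \<bar>f x\<bar> \<le> B"
  shows "(\<lambda>n. expectation (\<lambda>\<omega>. f ((\<Sum>i<n. X i \<omega>) / sqrt (real n)))) \<longlonglongrightarrow> (\<integral>x. f x \<partial>normal_law 0 v)"
proof -
  have rv[measurable]: "random_variable borel (X i)" for i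
    using indep unfolding indep_vars_def2 by blast
  have [measurable]: "f \<in> borel_measurable borel" by (rule borel_measurable_continuous_onI) fact
  have sqi: "integrable M (\<lambda>\<omega>. (X i \<omega>)\<^sup>2)" "expectation (\<lambda>\<omega>. (X i \<omega>)\<^sup>2) = v"
    and meani: "expectation (X i) = 0" for i
    using iid_expectation[where V = X and f = "\<lambda>x. x\<^sup>2", OF rv rv iid]
      iid_expectation[where V = X and f = "\<lambda>x. x", OF rv rv iid] sq var mean by auto
  have "v \<ge> 0" using var by (metis integral_nonneg_AE zero_le_power2 AE_I2)
  show ?thesis
  \<comment> \<open>The classical theorem requires positive variance. With variance 0 all
    \<open>X i\<close> vanish almost surely, and the limit is the point mass at 0.\<close>
  proof (cases "v = 0")
    case True
    have "AE \<omega> in M. X i \<omega> = 0" for i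
      using integral_nonneg_eq_0_iff_AE[OF sqi(1)] sqi(2) True by auto
    then have "AE \<omega> in M. \<forall>i. X i \<omega> = 0" by (simp add: AE_all_countable)
    then have "expectation (\<lambda>\<omega>. f ((\<Sum>i<n. X i \<omega>) / sqrt (real n))) = expectation (\<lambda>\<omega>. f 0)" for n
      by (intro integral_cong_AE) auto
    then show ?thesis using True by (simp add: normal_law_def integral_return prob_space)
  next
    case False
    with \<open>v \<ge> 0\<close> have "v > 0" by simp
    have clt: "weak_conv_m (\<lambda>n. distr M borel (\<lambda>\<omega>. (\<Sum>i<n. X i \<omega>) / sqrt (n * (sqrt v)\<^sup>2))) std_normal_distribution"
      by (rule central_limit_theorem_zero_mean[OF indep])
         (use meani sqi iid \<open>v > 0\<close> in \<open>auto\<close>)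
    \<comment> \<open>The classical theorem normalises by \<open>sqrt (n * v)\<close>; the factor
      \<open>sqrt v\<close> is shifted to the test function.\<close>
    define g where "g z = f (sqrt v * z)" for z
    have g: "continuous_on UNIV g" unfolding g_def
      by (rule continuous_on_compose2[OF f(1)]) (auto intro!: continuous_intros)
    have "(\<lambda>n. integral\<^sup>L (distr M borel (\<lambda>\<omega>. (\<Sum>i<n. X i \<omega>) / sqrt (n * (sqrt v)\<^sup>2))) g) \<longlonglongrightarrow> integral\<^sup>L std_normal_distribution g"
    proof (rule weak_conv_imp_integral_bdd_continuous_conv[OF _ _ clt])
      show "real_distribution std_normal_distribution" by (rule real_dist_normal_dist)
      show "isCont g z" for z using g by (simp add: continuous_on_eq_continuous_at)
      show "norm (g z) \<le> B" for z using f(2) by (simp add: g_def)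
    qed auto
    moreover have "integral\<^sup>L (distr M borel (\<lambda>\<omega>. (\<Sum>i<n. X i \<omega>) / sqrt (n * (sqrt v)\<^sup>2))) g
        = expectation (\<lambda>\<omega>. f ((\<Sum>i<n. X i \<omega>) / sqrt (real n)))" for n
    proof -
      have [measurable]: "g \<in> borel_measurable borel" by (rule borel_measurable_continuous_onI) fact
      show ?thesis using \<open>v > 0\<close>
        by (subst integral_distr) (auto simp: g_def real_sqrt_mult)
    qed
    moreover have "integral\<^sup>L std_normal_distribution g = (\<integral>x. f x \<partial>normal_law 0 v)"
      unfolding std_normal_scale[OF \<open>v > 0\<close>, symmetric] g_def
      by (subst integral_distr) auto
    ultimately show ?thesis by simp
  qed
qed

text \<open>The variables \<open>t \<bullet> V i\<close> are i.i.d. and centred with variance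
  \<open>t \<bullet> (S *v t)\<close>, so the univariate theorem yields the cosine expectations.
  Tightness is Chebyshev's inequality, the second moment of the normalised sum being the same for
  all positive \<open>n\<close>.\<close>

theorem (in prob_space) multivariate_central_limit_theorem:
  fixes V :: "nat \<Rightarrow> 'a \<Rightarrow> real ^ 'q"
  assumes indep: "indep_vars (\<lambda>_. borel) V UNIV"
    and iid: "\<And>i. distr M borel (V i) = distr M borel (V 0)"
    and sq: "integrable M (\<lambda>\<omega>. (norm (V 0 \<omega>))\<^sup>2)"
    and mean: "expectation (V 0) = 0"
    and S: "\<And>t. expectation (\<lambda>\<omega>. (t \<bullet> V 0 \<omega>)\<^sup>2) = t \<bullet> (S *v t)"
    and N: "is_normal_law N 0 S"
  shows "weak_conv_rv M (\<lambda>n \<omega>. (1 / sqrt (real n)) *\<^sub>R (\<Sum>i<n. V i \<omega>)) N"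
proof -
  have rv[measurable]: "random_variable borel (V i)" for i
    using indep unfolding indep_vars_def2 by blast
  let ?W = "\<lambda>n \<omega>. (1 / sqrt (real n)) *\<^sub>R (\<Sum>i<n. V i \<omega>)"
  have N': "prob_space N" "sets N = sets borel" "distr N borel (\<lambda>x. t \<bullet> x) = normal_law 0 (t \<bullet> (S *v t))" for t
    using N by (auto simp: is_normal_law_def)
  have int0: "integrable M (V 0)"
  proof (rule integrable_norm_cancel)
    show "integrable M (\<lambda>\<omega>. norm (V 0 \<omega>))"
      by (rule square_integrable_imp_integrable[OF _ sq]) measurable
  qed measurable
  define X where "X t i \<omega> = t \<bullet> V i \<omega>" for t i \<omega>
  have X_rv[measurable]: "random_variable borel (X t i)" for t i unfolding X_def by measurable
  have X_indep: "indep_vars (\<lambda>_. borel) (X t) UNIV" for t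
    unfolding X_def[abs_def] by (rule indep_vars_compose2[OF indep]) simp
  have X_iid: "distr M borel (X t i) = distr M borel (X t 0)" for t i
  proof -
    have "distr M borel (X t i) = distr (distr M borel (V i)) borel (\<lambda>x. t \<bullet> x)" for i
      by (subst distr_distr) (auto simp: comp_def X_def[abs_def])
    then show ?thesis using iid by metis
  qed
  have X_mean: "expectation (X t 0) = 0" for t
    using int0 mean by (simp add: X_def[abs_def])
  have X_sq: "integrable M (\<lambda>\<omega>. (X t 0 \<omega>)\<^sup>2)" for t
  proof (rule Bochner_Integration.integrable_bound)
    show "integrable M (\<lambda>\<omega>. (norm t)\<^sup>2 * (norm (V 0 \<omega>))\<^sup>2)" using sq by simp
    show "AE \<omega> in M. norm ((X t 0 \<omega>)\<^sup>2) \<le> norm ((norm t)\<^sup>2 * (norm (V 0 \<omega>))\<^sup>2)"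
    proof (rule AE_I2)
      fix \<omega>
      have "\<bar>X t 0 \<omega>\<bar>\<^sup>2 \<le> (norm t * norm (V 0 \<omega>))\<^sup>2"
        unfolding X_def by (intro power_mono Cauchy_Schwarz_ineq2) auto
      then show "norm ((X t 0 \<omega>)\<^sup>2) \<le> norm ((norm t)\<^sup>2 * (norm (V 0 \<omega>))\<^sup>2)"
        by (simp add: power_mult_distrib)
    qed
  qed measurable
  show ?thesis
  proof (rule weak_conv_rvI_trig[OF prob_space_axioms N'(1,2)])
    show "random_variable borel (?W n)" for n by measurable
    show "(\<lambda>n. expectation (\<lambda>\<omega>. cos (t \<bullet> ?W n \<omega> + b))) \<longlonglongrightarrow> (\<integral>x. cos (t \<bullet> x + b) \<partial>N)" for t b
    proof -
      have "(\<lambda>n. expectation (\<lambda>\<omega>. cos ((\<Sum>i<n. X t i \<omega>) / sqrt (real n) + b))) \<longlonglongrightarrow> (\<integral>x. cos (x + b) \<partial>normal_law 0 (t \<bullet> (S *v t)))"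
        by (rule clt_bounded_continuous[OF X_indep X_iid X_mean X_sq, where B = 1])
           (auto intro!: continuous_intros simp: X_def S)
      also have "(\<integral>x. cos (x + b) \<partial>normal_law 0 (t \<bullet> (S *v t))) = (\<integral>x. cos (t \<bullet> x + b) \<partial>N)"
        unfolding N'(3)[symmetric]
        by (subst integral_distr) (auto simp: N'(2) cong: measurable_cong_sets)
      finally show ?thesis by (simp add: X_def inner_sum_right)
    qed
    show "tight_rv M ?W"
      unfolding tight_rv_def
    proof (intro allI impI)
      fix e :: real assume "e > 0"
      define C where "C = (\<Sum>b\<in>Basis. expectation (\<lambda>\<omega>. (X b 0 \<omega>)\<^sup>2))"
      have norm_sq: "(norm (?W n \<omega>))\<^sup>2 = (\<Sum>b\<in>Basis. (1 / real n) * (\<Sum>i<n. X b i \<omega>)\<^sup>2)" for n \<omega>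
        by (subst power2_norm_eq_inner, subst euclidean_inner)
           (simp add: X_def inner_sum_left inner_sum_right inner_commute power2_eq_square sum_divide_distrib[symmetric])
      have sum_sq: "integrable M (\<lambda>\<omega>. (\<Sum>i<n. X b i \<omega>)\<^sup>2) \<and>
          expectation (\<lambda>\<omega>. (\<Sum>i<n. X b i \<omega>)\<^sup>2) = real n * expectation (\<lambda>\<omega>. (X b 0 \<omega>)\<^sup>2)" for b n
      proof -
        have *: "integrable M (\<lambda>\<omega>. (X b i \<omega>)\<^sup>2)" "expectation (\<lambda>\<omega>. (X b i \<omega>)\<^sup>2) = expectation (\<lambda>\<omega>. (X b 0 \<omega>)\<^sup>2)"
          "expectation (X b i) = 0" for i
          using iid_expectation[where V = "X b" and f = "\<lambda>x. x\<^sup>2", OF X_rv X_rv X_iid]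
            iid_expectation[where V = "X b" and f = "\<lambda>x. x", OF X_rv X_rv X_iid] X_sq X_mean by auto
        have "(\<Sum>i<n. expectation (\<lambda>\<omega>. (X b i \<omega>)\<^sup>2)) = (\<Sum>i<n. expectation (\<lambda>\<omega>. (X b 0 \<omega>)\<^sup>2))"
          by (intro sum.cong refl *(2))
        then show ?thesis
          using expectation_square_sum_indep[OF finite_lessThan indep_vars_subset[OF X_indep subset_UNIV] *(1,3), of n] by simp
      qed
      have int: "integrable M (\<lambda>\<omega>. (norm (?W n \<omega>))\<^sup>2)" for n
        unfolding norm_sq using sum_sq by auto
      have moment: "expectation (\<lambda>\<omega>. (norm (?W n \<omega>))\<^sup>2) = C" if "n > 0" for n
        unfolding norm_sq using sum_sq that by (simp add: C_def)
      have "C \<ge> 0" unfolding C_def by (intro sum_nonneg integral_nonneg) auto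
      \<comment> \<open>Then \<open>C / A\<^sup>2 = e * C / (C + 1) < e\<close>; the added 1 keeps
        \<open>A\<close> positive when \<open>C = 0\<close>.\<close>
      define A where "A = sqrt ((C + 1) / e)"
      have A: "A > 0" "C / A\<^sup>2 < e" using \<open>e > 0\<close> \<open>C \<ge> 0\<close> by (auto simp: A_def field_simps)
      have "prob {\<omega>\<in>space M. norm (?W n \<omega>) > A} < e" if "n > 0" for n
      proof -
        have "prob {\<omega>\<in>space M. norm (?W n \<omega>) > A} \<le> prob {\<omega>\<in>space M. \<bar>norm (?W n \<omega>)\<bar> \<ge> A}"
          by (intro finite_measure_mono) auto
        also have "\<dots> \<le> expectation (\<lambda>\<omega>. (norm (?W n \<omega>))\<^sup>2) / A\<^sup>2"
          by (rule second_moment_method[OF _ int A(1)]) measurable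
        finally show ?thesis using A(2) moment[OF that] by simp
      qed
      then have "\<forall>\<^sub>F n in sequentially. prob {\<omega>\<in>space M. norm (?W n \<omega>) > A} < e"
        by (intro eventually_mono[OF eventually_gt_at_top[of 0]])
      then show "\<exists>A>0. \<forall>\<^sub>F n in sequentially. prob {\<omega>\<in>space M. norm (?W n \<omega>) > A} < e"
        using A(1) by blast
    qed
  qed
qed

subsection \<open>Convergence in probability\<close>

lemma conv_in_probI:
  fixes Y :: "nat \<Rightarrow> 'w \<Rightarrow> 'b::euclidean_space"
  assumes "\<And>n. Y n \<in> borel_measurable M"
    and "\<And>e d. e > 0 \<Longrightarrow> d > 0 \<Longrightarrow> \<forall>\<^sub>F n in sequentially. measure M {\<omega>\<in>space M. dist (Y n \<omega>) L > e} < d"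
  shows "conv_in_prob M Y L"
  unfolding conv_in_prob_def
proof (intro conjI allI impI assms(1))
  fix e :: real assume "e > 0"
  show "(\<lambda>n. measure M {\<omega>\<in>space M. dist (Y n \<omega>) L > e}) \<longlonglongrightarrow> 0"
  proof (rule order_tendstoI)
    fix a :: real
    show "a < 0 \<Longrightarrow> \<forall>\<^sub>F n in sequentially. a < measure M {\<omega>\<in>space M. dist (Y n \<omega>) L > e}"
      using measure_nonneg less_le_trans by (intro always_eventually allI) blast
    show "0 < a \<Longrightarrow> \<forall>\<^sub>F n in sequentially. measure M {\<omega>\<in>space M. dist (Y n \<omega>) L > e} < a"
      by (rule assms(2)[OF \<open>e > 0\<close>])
  qed
qed

lemma conv_in_prob_eventually:
  "conv_in_prob M Y L \<Longrightarrow> e > 0 \<Longrightarrow> d > 0 \<Longrightarrow>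
    \<forall>\<^sub>F n in sequentially. measure M {\<omega>\<in>space M. dist (Y n \<omega>) L > e} < d"
  by (rule order_tendstoD(2)[OF conv_in_probD])

lemma conv_in_prob_const_seq:
  fixes a :: "nat \<Rightarrow> 'b::euclidean_space"
  assumes "a \<longlonglongrightarrow> L"
  shows "conv_in_prob M (\<lambda>n \<omega>. a n) L"
proof (rule conv_in_probI)
  fix e d :: real assume "e > 0" "d > 0"
  have "\<forall>\<^sub>F n in sequentially. dist (a n) L < e" using assms \<open>e > 0\<close> by (rule tendstoD)
  then show "\<forall>\<^sub>F n in sequentially. measure M {\<omega>\<in>space M. dist (a n) L > e} < d"
    by eventually_elim (use \<open>d > 0\<close> in simp)
qed simp

text \<open>Values far from \<open>L\<close> have vanishing probability, so continuity at the single
  point \<open>L\<close> suffices. It does not imply measurability of the composition, which is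
  therefore assumed separately; the difference quotients and reciprocal derivatives to come are
  controlled only near the limit.\<close>

lemma conv_in_prob_isCont:
  fixes f :: "'b::euclidean_space \<Rightarrow> 'c::euclidean_space"
  assumes "prob_space M" and Y: "conv_in_prob M Y L" and f: "isCont f L"
    and meas: "\<And>n. (\<lambda>\<omega>. f (Y n \<omega>)) \<in> borel_measurable M"
  shows "conv_in_prob M (\<lambda>n \<omega>. f (Y n \<omega>)) (f L)"
proof (rule conv_in_probI[OF meas])
  interpret prob_space M by fact
  have [measurable]: "Y n \<in> borel_measurable M" for n using Y by (rule conv_in_prob_measurable)
  fix e d :: real assume "e > 0" "d > 0"
  obtain r where r: "r > 0" "\<And>x. dist x L < r \<Longrightarrow> dist (f x) (f L) < e"
    using f \<open>e > 0\<close> unfolding continuous_at_eps_delta by blast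
  have "\<forall>\<^sub>F n in sequentially. prob {\<omega>\<in>space M. dist (Y n \<omega>) L > r / 2} < d"
    by (rule conv_in_prob_eventually[OF Y]) (use r \<open>d > 0\<close> in auto)
  then show "\<forall>\<^sub>F n in sequentially. prob {\<omega>\<in>space M. dist (f (Y n \<omega>)) (f L) > e} < d"
  proof eventually_elim
    case (elim n)
    have "dist (f x) (f L) \<le> e" if "dist x L \<le> r / 2" for x
      by (rule less_imp_le, rule r(2)) (use that r(1) in linarith)
    then have "{\<omega>\<in>space M. dist (f (Y n \<omega>)) (f L) > e} \<subseteq> {\<omega>\<in>space M. dist (Y n \<omega>) L > r / 2}"
      by (fastforce simp: not_le[symmetric])
    then have "prob {\<omega>\<in>space M. dist (f (Y n \<omega>)) (f L) > e} \<le> prob {\<omega>\<in>space M. dist (Y n \<omega>) L > r / 2}"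
      by (rule finite_measure_mono) measurable
    then show ?case using elim by simp
  qed
qed

text \<open>Convergence of the components is joint because the limits are constants. Arithmetic of
  limits then reduces to continuity of the operations on pairs.\<close>

lemma conv_in_prob_Pair:
  fixes Y :: "nat \<Rightarrow> 'w \<Rightarrow> 'b::euclidean_space" and Z :: "nat \<Rightarrow> 'w \<Rightarrow> 'c::euclidean_space"
  assumes "prob_space M" and Y: "conv_in_prob M Y K" and Z: "conv_in_prob M Z L"
  shows "conv_in_prob M (\<lambda>n \<omega>. (Y n \<omega>, Z n \<omega>)) (K, L)"
proof (rule conv_in_probI)
  interpret prob_space M by fact
  have [measurable]: "Y n \<in> borel_measurable M" "Z n \<in> borel_measurable M" for n
    using Y Z by (auto intro: conv_in_prob_measurable)
  show "(\<lambda>\<omega>. (Y n \<omega>, Z n \<omega>)) \<in> borel_measurable M" for n by measurable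
  fix e d :: real assume "e > 0" "d > 0"
  have "\<forall>\<^sub>F n in sequentially. prob {\<omega>\<in>space M. dist (Y n \<omega>) K > e / 2} < d / 2"
    "\<forall>\<^sub>F n in sequentially. prob {\<omega>\<in>space M. dist (Z n \<omega>) L > e / 2} < d / 2"
    using conv_in_prob_eventually[OF Y, of "e / 2" "d / 2"] conv_in_prob_eventually[OF Z, of "e / 2" "d / 2"] \<open>e > 0\<close> \<open>d > 0\<close>
    by simp_all
  then show "\<forall>\<^sub>F n in sequentially. prob {\<omega>\<in>space M. dist (Y n \<omega>, Z n \<omega>) (K, L) > e} < d"
  proof eventually_elim
    case (elim n)
    have "dist (Y n \<omega>, Z n \<omega>) (K, L) \<le> dist (Y n \<omega>) K + dist (Z n \<omega>) L" for \<omega>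
      by (simp add: dist_Pair_Pair sqrt_sum_squares_le_sum)
    then have "e < dist (Y n \<omega>, Z n \<omega>) (K, L) \<Longrightarrow> e / 2 < dist (Y n \<omega>) K \<or> e / 2 < dist (Z n \<omega>) L" for \<omega>
      by (smt (verit, best) field_sum_of_halves)
    then have "{\<omega>\<in>space M. dist (Y n \<omega>, Z n \<omega>) (K, L) > e} \<subseteq>
        {\<omega>\<in>space M. dist (Y n \<omega>) K > e / 2} \<union> {\<omega>\<in>space M. dist (Z n \<omega>) L > e / 2}"
      by auto
    then have "prob {\<omega>\<in>space M. dist (Y n \<omega>, Z n \<omega>) (K, L) > e} \<le>
        prob ({\<omega>\<in>space M. dist (Y n \<omega>) K > e / 2} \<union> {\<omega>\<in>space M. dist (Z n \<omega>) L > e / 2})"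
      by (rule finite_measure_mono) measurable
    also have "\<dots> \<le> prob {\<omega>\<in>space M. dist (Y n \<omega>) K > e / 2} + prob {\<omega>\<in>space M. dist (Z n \<omega>) L > e / 2}"
      by (rule measure_Un_le) measurable
    finally show ?case using elim by simp
  qed
qed

lemma conv_in_prob_mult:
  fixes Y Z :: "nat \<Rightarrow> 'w \<Rightarrow> real"
  assumes "prob_space M" "conv_in_prob M Y K" "conv_in_prob M Z L"
  shows "conv_in_prob M (\<lambda>n \<omega>. Y n \<omega> * Z n \<omega>) (K * L)"
proof -
  have [measurable]: "Y n \<in> borel_measurable M" "Z n \<in> borel_measurable M" for n
    using assms by (auto intro: conv_in_prob_measurable)
  have "isCont (\<lambda>x::real\<times>real. fst x * snd x) (K, L)" by (intro continuous_intros)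
  from conv_in_prob_isCont[OF assms(1) conv_in_prob_Pair[OF assms] this] show ?thesis by simp
qed

lemma conv_in_prob_diff:
  fixes Y Z :: "nat \<Rightarrow> 'w \<Rightarrow> real"
  assumes "prob_space M" "conv_in_prob M Y K" "conv_in_prob M Z L"
  shows "conv_in_prob M (\<lambda>n \<omega>. Y n \<omega> - Z n \<omega>) (K - L)"
proof -
  have [measurable]: "Y n \<in> borel_measurable M" "Z n \<in> borel_measurable M" for n
    using assms by (auto intro: conv_in_prob_measurable)
  have "isCont (\<lambda>x::real\<times>real. fst x - snd x) (K, L)" by (intro continuous_intros)
  from conv_in_prob_isCont[OF assms(1) conv_in_prob_Pair[OF assms] this] show ?thesis by simp
qed

lemma conv_in_prob_scaleR:
  fixes Y :: "nat \<Rightarrow> 'w \<Rightarrow> real" and v :: "'b::euclidean_space"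
  assumes "prob_space M" "conv_in_prob M Y K"
  shows "conv_in_prob M (\<lambda>n \<omega>. Y n \<omega> *\<^sub>R v) (K *\<^sub>R v)"
proof -
  have [measurable]: "Y n \<in> borel_measurable M" for n
    using assms by (auto intro: conv_in_prob_measurable)
  have "isCont (\<lambda>x. x *\<^sub>R v) K" by (intro continuous_intros)
  from conv_in_prob_isCont[OF assms this] show ?thesis by simp
qed

lemma conv_in_prob_sum:
  fixes Y :: "'i \<Rightarrow> nat \<Rightarrow> 'w \<Rightarrow> 'b::euclidean_space"
  assumes "prob_space M" "finite J" "\<And>i. i \<in> J \<Longrightarrow> conv_in_prob M (Y i) (L i)"
  shows "conv_in_prob M (\<lambda>n \<omega>. \<Sum>i\<in>J. Y i n \<omega>) (\<Sum>i\<in>J. L i)"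
  using assms(2,3)
proof (induction J rule: finite_induct)
  case empty
  then show ?case using conv_in_prob_const_seq[OF tendsto_const, of M 0] by simp
next
  case (insert i J)
  have [measurable]: "Y i n \<in> borel_measurable M" "(\<lambda>\<omega>. \<Sum>i\<in>J. Y i n \<omega>) \<in> borel_measurable M" for n
    using insert by (auto intro!: conv_in_prob_measurable borel_measurable_sum)
  have "isCont (\<lambda>x::'b\<times>'b. fst x + snd x) (L i, \<Sum>i\<in>J. L i)" by (intro continuous_intros)
  from conv_in_prob_isCont[OF assms(1) conv_in_prob_Pair[OF assms(1) insert.prems[OF insertI1] insert.IH[OF insert.prems[OF insertI2]]] this]
  show ?case using insert.hyps by simp
qed

lemma conv_in_prob_componentwise:
  fixes Y :: "nat \<Rightarrow> 'w \<Rightarrow> 'b::euclidean_space"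
  assumes "prob_space M" "\<And>b. b \<in> Basis \<Longrightarrow> conv_in_prob M (\<lambda>n \<omega>. Y n \<omega> \<bullet> b) (L \<bullet> b)"
  shows "conv_in_prob M Y L"
proof -
  have "conv_in_prob M (\<lambda>n \<omega>. \<Sum>b\<in>Basis. (Y n \<omega> \<bullet> b) *\<^sub>R b) (\<Sum>b\<in>Basis. (L \<bullet> b) *\<^sub>R b)"
    by (intro conv_in_prob_sum conv_in_prob_scaleR assms finite_Basis)
  then show ?thesis by (simp add: euclidean_representation)
qed

lemma conv_in_prob_vec:
  fixes Y :: "nat \<Rightarrow> 'w \<Rightarrow> real ^ 'q"
  assumes "prob_space M" "\<And>i. conv_in_prob M (\<lambda>n \<omega>. Y n \<omega> $ i) (L $ i)"
  shows "conv_in_prob M Y L"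
  by (rule conv_in_prob_componentwise[OF assms(1)]) (use assms(2) in \<open>auto simp: Basis_vec_def inner_axis\<close>)

lemma conv_in_prob_mat:
  fixes Y :: "nat \<Rightarrow> 'w \<Rightarrow> real ^ 'q ^ 'r"
  assumes "prob_space M" "\<And>i j. conv_in_prob M (\<lambda>n \<omega>. Y n \<omega> $ i $ j) (L $ i $ j)"
  shows "conv_in_prob M Y L"
  by (rule conv_in_prob_componentwise[OF assms(1)]) (use assms(2) in \<open>auto simp: Basis_vec_def inner_axis\<close>)

text \<open>Tightness fixes a bound \<open>A\<close> for \<open>Z\<close> up to small probability;
  then \<open>Y\<close> is eventually below \<open>e / A\<close> up to small probability. This
  disposes of the linearisation error.\<close>

lemma conv_in_prob_mult_tight:
  fixes Y Z :: "nat \<Rightarrow> 'w \<Rightarrow> real"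
  assumes "prob_space M" and Y: "conv_in_prob M Y 0"
    and Z: "tight_rv M Z" and [measurable]: "\<And>n. Z n \<in> borel_measurable M"
  shows "conv_in_prob M (\<lambda>n \<omega>. Y n \<omega> * Z n \<omega>) 0"
proof (rule conv_in_probI)
  interpret prob_space M by fact
  have [measurable]: "Y n \<in> borel_measurable M" for n
    using Y by (rule conv_in_prob_measurable)
  show "(\<lambda>\<omega>. Y n \<omega> * Z n \<omega>) \<in> borel_measurable M" for n by measurable
  fix e d :: real assume "e > 0" "d > 0"
  then obtain A where A: "A > 0" "\<forall>\<^sub>F n in sequentially. prob {\<omega>\<in>space M. norm (Z n \<omega>) > A} < d / 2"
    using Z unfolding tight_rv_def by (meson half_gt_zero)
  have "\<forall>\<^sub>F n in sequentially. prob {\<omega>\<in>space M. dist (Y n \<omega>) 0 > e / A} < d / 2"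
    by (rule conv_in_prob_eventually[OF Y]) (use A \<open>e > 0\<close> \<open>d > 0\<close> in auto)
  with A(2) show "\<forall>\<^sub>F n in sequentially. prob {\<omega>\<in>space M. dist (Y n \<omega> * Z n \<omega>) 0 > e} < d"
  proof eventually_elim
    case (elim n)
    have "\<bar>Y n \<omega> * Z n \<omega>\<bar> \<le> e" if "\<bar>Y n \<omega>\<bar> \<le> e / A" "\<bar>Z n \<omega>\<bar> \<le> A" for \<omega>
    proof -
      have "\<bar>Y n \<omega> * Z n \<omega>\<bar> \<le> e / A * A" unfolding abs_mult using that A(1) \<open>e > 0\<close> by (intro mult_mono) auto
      then show ?thesis using A(1) by simp
    qed
    then have "{\<omega>\<in>space M. dist (Y n \<omega> * Z n \<omega>) 0 > e} \<subseteq>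
        {\<omega>\<in>space M. norm (Z n \<omega>) > A} \<union> {\<omega>\<in>space M. dist (Y n \<omega>) 0 > e / A}"
      unfolding dist_norm real_norm_def diff_zero by (auto simp: not_less) (meson not_less)
    then have "prob {\<omega>\<in>space M. dist (Y n \<omega> * Z n \<omega>) 0 > e} \<le>
        prob ({\<omega>\<in>space M. norm (Z n \<omega>) > A} \<union> {\<omega>\<in>space M. dist (Y n \<omega>) 0 > e / A})"
      by (rule finite_measure_mono) measurable
    also have "\<dots> \<le> prob {\<omega>\<in>space M. norm (Z n \<omega>) > A} + prob {\<omega>\<in>space M. dist (Y n \<omega>) 0 > e / A}"
      by (rule measure_Un_le) measurable
    finally show ?case using elim by simp
  qed
qed

subsection \<open>Inverting the transformation\<close>

definition uniform_quotient_set :: "(real \<Rightarrow> real) \<Rightarrow> real set \<Rightarrow> real \<Rightarrow> real \<Rightarrow> real set" where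
  "uniform_quotient_set G I d e = {x. ball x d \<subseteq> I \<and>
     (\<forall>h k. 0 < \<bar>h\<bar> \<and> \<bar>h\<bar> < d \<and> 0 < \<bar>k\<bar> \<and> \<bar>k\<bar> < d \<longrightarrow>
       \<bar>(G (x + h) - G x) / h - (G (x + k) - G x) / k\<bar> \<le> e)}"

text \<open>Requiring \<open>ball x d\<close> inside \<open>I\<close> makes the quotients continuous
  in \<open>x\<close> for all steps shorter than \<open>d\<close>, and the bound is not strict.
  Closedness is what survives the intersection over uncountably many steps; measurability in general
  would not.\<close>

lemma closed_uniform_quotient_set:
  assumes cont: "continuous_on I G" and d: "d > 0"
  shows "closed (uniform_quotient_set G I d e)"
proof -
  define J where "J = {x. ball x d \<subseteq> I}"
  \<comment> \<open>A point is in \<open>J\<close> when all points off \<open>I\<close> have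
    distance at least \<open>d\<close> from it, a closed condition for each of them.\<close>
  have "J = (\<Inter>y\<in>-I. {x. d \<le> dist x y})"
    by (auto simp: J_def subset_eq not_less[symmetric])
  also have "closed \<dots>"
    by (intro closed_INT ballI closed_Collect_le continuous_intros)
  finally have J: "closed J" .
  have "uniform_quotient_set G I d e = J \<inter> (\<Inter>h\<in>{h. 0 < \<bar>h\<bar> \<and> \<bar>h\<bar> < d}. \<Inter>k\<in>{k. 0 < \<bar>k\<bar> \<and> \<bar>k\<bar> < d}.
      {x\<in>J. \<bar>(G (x + h) - G x) / h - (G (x + k) - G x) / k\<bar> \<le> e})"
    by (auto simp: uniform_quotient_set_def J_def)
  also have "closed \<dots>"
  proof (intro closed_Int J closed_INT ballI)
    fix h k assume "h \<in> {h. 0 < \<bar>h\<bar> \<and> \<bar>h\<bar> < d}" "k \<in> {k. 0 < \<bar>k\<bar> \<and> \<bar>k\<bar> < d}"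
    moreover have "continuous_on J (\<lambda>x. G (x + h))" if "\<bar>h\<bar> < d" for h
    proof (rule continuous_on_compose2[OF cont])
      show "(\<lambda>x. x + h) ` J \<subseteq> I"
        using that by (force simp: J_def dist_real_def)
    qed (intro continuous_intros)
    moreover have "continuous_on J G"
      by (rule continuous_on_subset[OF cont]) (use d in \<open>force simp: J_def\<close>)
    ultimately have "continuous_on J (\<lambda>x. \<bar>(G (x + h) - G x) / h - (G (x + k) - G x) / k\<bar>)"
      by (intro continuous_intros) auto
    then show "closed {x\<in>J. \<bar>(G (x + h) - G x) / h - (G (x + k) - G x) / k\<bar> \<le> e}"
      by (intro continuous_on_closed_Collect_le continuous_on_const J)
  qed
  finally show ?thesis .
qed

text \<open>Cauchy's criterion eliminates the unknown value of the derivative, and tolerances and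
  radii of the form \<open>1 / (n + 1)\<close> leave countable quantifiers only.\<close>

lemma differentiable_iff_uniform_quotient:
  fixes G :: "real \<Rightarrow> real"
  assumes "open I"
  shows "x \<in> I \<and> G differentiable (at x) \<longleftrightarrow>
    (\<forall>k::nat. \<exists>m::nat. x \<in> uniform_quotient_set G I (inverse (Suc m)) (inverse (Suc k)))"
proof (intro iffI conjI allI)
  fix k :: nat
  assume x: "x \<in> I \<and> G differentiable (at x)"
  then obtain r where r: "r > 0" "ball x r \<subseteq> I" using \<open>open I\<close> open_contains_ball by blast
  obtain D where "(G has_real_derivative D) (at x)" using x by (auto simp: real_differentiable_def)
  then have "((\<lambda>h. (G (x + h) - G x) / h) \<longlongrightarrow> D) (at 0)" by (simp add: DERIV_def)
  then obtain s where s: "s > 0" "\<And>h. h \<noteq> 0 \<Longrightarrow> \<bar>h\<bar> < s \<Longrightarrow> \<bar>(G (x + h) - G x) / h - D\<bar> < inverse (Suc k) / 2"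
    unfolding LIM_def dist_real_def
    by (metis diff_zero half_gt_zero inverse_positive_iff_positive of_nat_0_less_iff zero_less_Suc)
  obtain m where m: "inverse (Suc m) < min r s" using reals_Archimedean[of "min r s"] r s by auto
  have "\<bar>(G (x + h) - G x) / h - (G (x + k') - G x) / k'\<bar> \<le> inverse (Suc k)"
    if "0 < \<bar>h\<bar> \<and> \<bar>h\<bar> < inverse (Suc m) \<and> 0 < \<bar>k'\<bar> \<and> \<bar>k'\<bar> < inverse (Suc m)" for h k'
  proof -
    have "\<bar>(G (x + h) - G x) / h - D\<bar> < inverse (Suc k) / 2" "\<bar>(G (x + k') - G x) / k' - D\<bar> < inverse (Suc k) / 2"
      by (rule s(2); use that m in force)+
    then show ?thesis by linarith
  qed
  moreover have "ball x (inverse (Suc m)) \<subseteq> I" using r(2) m by (force simp: subset_eq)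
  ultimately show "\<exists>m. x \<in> uniform_quotient_set G I (inverse (Suc m)) (inverse (Suc k))"
    unfolding uniform_quotient_set_def by blast
next
  assume *: "\<forall>k::nat. \<exists>m::nat. x \<in> uniform_quotient_set G I (inverse (Suc m)) (inverse (Suc k))"
  then obtain m where "ball x (inverse (Suc m)) \<subseteq> I" unfolding uniform_quotient_set_def by blast
  then show "x \<in> I" by (auto simp: subset_eq)
  define Q where "Q h = (G (x + h) - G x) / h" for h
  have Q: "\<exists>d>0. \<forall>h k. 0 < \<bar>h\<bar> \<and> \<bar>h\<bar> < d \<and> 0 < \<bar>k\<bar> \<and> \<bar>k\<bar> < d \<longrightarrow> \<bar>Q h - Q k\<bar> \<le> e" if e: "e > 0" for e
  proof -
    obtain k where k: "inverse (real (Suc k)) < e" using reals_Archimedean[OF e] by auto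
    obtain m where "x \<in> uniform_quotient_set G I (inverse (Suc m)) (inverse (Suc k))" using * by blast
    then have "\<forall>h k. 0 < \<bar>h\<bar> \<and> \<bar>h\<bar> < inverse (Suc m) \<and> 0 < \<bar>k\<bar> \<and> \<bar>k\<bar> < inverse (Suc m) \<longrightarrow> \<bar>Q h - Q k\<bar> \<le> e"
      unfolding uniform_quotient_set_def Q_def using k by force
    then show ?thesis by (intro exI[of _ "inverse (Suc m)"]) auto
  qed
  \<comment> \<open>The candidate derivative is found along the steps \<open>1 / (n + 1)\<close>;
    the Cauchy bound then extends the limit to all steps.\<close>
  have "Cauchy (\<lambda>n. Q (inverse (Suc n)))"
  proof (rule metric_CauchyI)
    fix e :: real assume "e > 0"
    then obtain d where d: "d > 0" "\<And>h k. 0 < \<bar>h\<bar> \<and> \<bar>h\<bar> < d \<and> 0 < \<bar>k\<bar> \<and> \<bar>k\<bar> < d \<Longrightarrow> \<bar>Q h - Q k\<bar> \<le> e / 2"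
      using Q[of "e / 2"] by auto
    obtain N where N: "inverse (real (Suc N)) < d" using reals_Archimedean[OF d(1)] by auto
    have "dist (Q (inverse (Suc m))) (Q (inverse (Suc n))) < e" if "m \<ge> N" "n \<ge> N" for m n
    proof -
      have "inverse (real (Suc j)) < d" if "j \<ge> N" for j
        by (rule le_less_trans[OF _ N]) (use that in \<open>auto intro!: le_imp_inverse_le\<close>)
      then have "\<bar>Q (inverse (Suc m)) - Q (inverse (Suc n))\<bar> \<le> e / 2"
        using that by (intro d(2)) auto
      then show ?thesis using \<open>e > 0\<close> by (simp add: dist_real_def)
    qed
    then show "\<exists>N. \<forall>m\<ge>N. \<forall>n\<ge>N. dist (Q (inverse (Suc m))) (Q (inverse (Suc n))) < e" by blast
  qed
  then obtain D where D: "(\<lambda>n. Q (inverse (Suc n))) \<longlonglongrightarrow> D"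
    using Cauchy_convergent convergent_def by blast
  have "(Q \<longlongrightarrow> D) (at 0)"
    unfolding LIM_def
  proof (intro allI impI)
    fix e :: real assume "e > 0"
    then obtain d where d: "d > 0" "\<And>h k. 0 < \<bar>h\<bar> \<and> \<bar>h\<bar> < d \<and> 0 < \<bar>k\<bar> \<and> \<bar>k\<bar> < d \<Longrightarrow> \<bar>Q h - Q k\<bar> \<le> e / 2"
      using Q[of "e / 2"] by auto
    have "\<bar>Q h - D\<bar> \<le> e / 2" if "h \<noteq> 0" "\<bar>h\<bar> < d" for h
    proof (rule tendsto_upperbound)
      show "(\<lambda>n. \<bar>Q h - Q (inverse (Suc n))\<bar>) \<longlonglongrightarrow> \<bar>Q h - D\<bar>" by (intro tendsto_intros D)
      have "\<forall>\<^sub>F n in sequentially. inverse (real (Suc n)) < d"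
        using order_tendstoD(2)[OF LIMSEQ_inverse_real_of_nat d(1)] .
      then show "\<forall>\<^sub>F n in sequentially. \<bar>Q h - Q (inverse (Suc n))\<bar> \<le> e / 2"
        by eventually_elim (rule d(2), use that in auto)
    qed simp
    then show "\<exists>s>0. \<forall>h. h \<noteq> 0 \<and> dist h 0 < s \<longrightarrow> dist (Q h) D < e"
      using d(1) \<open>e > 0\<close> by (intro exI[of _ d]) (force simp: dist_real_def)
  qed
  then have "(G has_real_derivative D) (at x)" by (simp add: DERIV_def Q_def[abs_def])
  then show "G differentiable (at x)" by (auto simp: real_differentiable_def)
qed

lemma borel_differentiable_set:
  fixes G :: "real \<Rightarrow> real"
  assumes "open I" "continuous_on I G"
  shows "{x\<in>I. G differentiable (at x)} \<in> sets borel"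
proof -
  have "{x\<in>I. G differentiable (at x)} =
      (\<Inter>k. \<Union>m. uniform_quotient_set G I (inverse (Suc m)) (inverse (Suc k)))"
    using differentiable_iff_uniform_quotient[OF assms(1), of _ G] by auto
  also have "\<dots> \<in> sets borel"
    by (intro sets.countable_INT sets.countable_UN image_subsetI borel_closed closed_uniform_quotient_set assms(2)) auto
  finally show ?thesis .
qed

lemma borel_measurable_deriv_on:
  fixes G :: "real \<Rightarrow> real"
  assumes "open I" "continuous_on I G"
  shows "(\<lambda>x. if x \<in> I \<and> G differentiable (at x) then deriv G x else 0) \<in> borel_measurable borel"
proof -
  define D where "D = {x\<in>I. G differentiable (at x)}"
  have [measurable]: "D \<in> sets borel" unfolding D_def by (rule borel_differentiable_set[OF assms])
  \<comment> \<open>Extension by 0 gives a Borel function on the whole line. As \<open>I\<close> is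
    open, its quotients at a point of \<open>I\<close> eventually agree with those of
    \<open>G\<close>.\<close>
  define H where "H x = (if x \<in> I then G x else 0)" for x
  have [measurable]: "H \<in> borel_measurable borel"
    unfolding H_def by (intro borel_measurable_continuous_on_if assms continuous_on_const borel_open)
  have "lim (\<lambda>n. (H (x + inverse (Suc n)) - H x) / inverse (Suc n)) = deriv G x" if "x \<in> D" for x
  proof -
    have x: "x \<in> I" "(G has_real_derivative deriv G x) (at x)"
      using that by (auto simp: D_def DERIV_deriv_iff_real_differentiable)
    then have "((\<lambda>h. (G (x + h) - G x) / h) \<longlongrightarrow> deriv G x) (at 0)" by (simp add: DERIV_def)
    then have lim: "(\<lambda>n. (G (x + inverse (Suc n)) - G x) / inverse (Suc n)) \<longlonglongrightarrow> deriv G x"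
      by (rule filterlim_compose) (use LIMSEQ_inverse_real_of_nat in \<open>auto simp: filterlim_at\<close>)
    have "(\<lambda>n. x + inverse (Suc n)) \<longlonglongrightarrow> x + 0"
      by (intro tendsto_intros LIMSEQ_inverse_real_of_nat)
    then have "\<forall>\<^sub>F n in sequentially. x + inverse (Suc n) \<in> I"
      using x(1) assms(1) by (auto dest!: topological_tendstoD)
    then have "\<forall>\<^sub>F n in sequentially. (G (x + inverse (Suc n)) - G x) / inverse (Suc n)
        = (H (x + inverse (Suc n)) - H x) / inverse (Suc n)"
      by eventually_elim (use x(1) in \<open>simp add: H_def\<close>)
    then have "(\<lambda>n. (H (x + inverse (Suc n)) - H x) / inverse (Suc n)) \<longlonglongrightarrow> deriv G x"
      by (rule Lim_transform_eventually[OF lim])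
    then show ?thesis by (rule limI)
  qed
  then have "(\<lambda>x. if x \<in> I \<and> G differentiable (at x) then deriv G x else 0) =
      (\<lambda>x. if x \<in> D then lim (\<lambda>n. (H (x + inverse (Suc n)) - H x) / inverse (Suc n)) else 0)"
    by (auto simp: D_def)
  also have "\<dots> \<in> borel_measurable borel" by measurable
  finally show ?thesis .
qed

section \<open>Inverse of the bijection: continuity, measurability, derivative\<close>

locale interval_bijection =
  fixes I :: "real set" and G :: "real \<Rightarrow> real"
  assumes I: "is_interval I" and cont: "continuous_on I G"
    and mono: "strict_mono_on I G" and bij: "bij_betw G I {0<..<1}"
begin

text \<open>The values \<open>G x / 2\<close> and \<open>(1 + G x) / 2\<close> are attained on
  either side of \<open>x\<close>, and the interval between these two points lies in
  \<open>I\<close>.\<close>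

lemma open_domain: "open I"
proof (subst open_subopen, intro ballI)
  fix x assume x: "x \<in> I"
  then have "G x \<in> {0<..<1}" using bij by (auto simp: bij_betw_def)
  then have "G x / 2 \<in> G ` I" "(1 + G x) / 2 \<in> G ` I" using bij by (auto simp: bij_betw_def)
  then obtain y z where yz: "y \<in> I" "z \<in> I" "G y = G x / 2" "G z = (1 + G x) / 2" by force
  then have "G y < G x" "G x < G z" using \<open>G x \<in> {0<..<1}\<close> by auto
  then have "y < x" "x < z"
    using strict_mono_on_less[OF mono yz(1) x] strict_mono_on_less[OF mono x yz(2)] by blast+
  moreover have "w \<in> I" if "w \<in> {y<..<z}" for w
    using mem_is_interval_1_I[OF I yz(1,2), of w] that by auto
  ultimately have "x \<in> {y<..<z}" "{y<..<z} \<subseteq> I" by auto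
  then show "\<exists>T. open T \<and> x \<in> T \<and> T \<subseteq> I" using open_greaterThanLessThan by blast
qed

lemma inverse_range: "y \<in> {0<..<1} \<Longrightarrow> inv_into I G y \<in> I"
  and inverse_right: "y \<in> {0<..<1} \<Longrightarrow> G (inv_into I G y) = y"
  using bij by (auto simp: bij_betw_def inv_into_into f_inv_into_f)

text \<open>A monotone function with open image has no jumps; here the image is
  \<open>I\<close>.\<close>

lemma continuous_on_inverse: "continuous_on {0<..<1} (inv_into I G)"
proof (rule continuous_onI_mono)
  have "inv_into I G ` {0<..<1} = I"
    using bij_betw_inv_into[OF bij] by (simp add: bij_betw_def)
  then show "open (inv_into I G ` {0<..<1})" using open_domain by simp
  show "inv_into I G x \<le> inv_into I G y" if "x \<in> {0<..<1}" "y \<in> {0<..<1}" "x \<le> y" for x y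
    using strict_mono_on_less_eq[OF mono inverse_range inverse_range] inverse_right that by metis
qed

lemma isCont_inverse: "y \<in> {0<..<1} \<Longrightarrow> isCont (inv_into I G) y"
  using continuous_on_inverse by (simp add: continuous_on_eq_continuous_at)

text \<open>Outside the range of \<open>G\<close>, \<^const>\<open>inv_into\<close> picks a fixed unspecified point.\<close>

lemma inverse_junk: "y \<notin> {0<..<1} \<Longrightarrow> inv_into I G y = (SOME x. False)"
proof -
  assume "y \<notin> {0<..<1}"
  moreover have "x \<in> I \<Longrightarrow> G x \<in> {0<..<1}" for x using bij by (auto simp: bij_betw_def)
  ultimately have "(\<lambda>x. x \<in> I \<and> G x = y) = (\<lambda>x. False)" by blast
  then show ?thesis unfolding inv_into_def by (rule arg_cong)
qed

lemma borel_measurable_inverse: "inv_into I G \<in> borel_measurable borel"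
proof -
  have "inv_into I G = (\<lambda>y. if y \<in> {0<..<1} then inv_into I G y else (SOME x. False))"
    using inverse_junk by auto
  also have "\<dots> \<in> borel_measurable borel"
    by (intro borel_measurable_continuous_on_if continuous_on_inverse continuous_on_const) auto
  finally show ?thesis .
qed

lemma borel_measurable_reciprocal_deriv_inverse:
  fixes h :: "real \<Rightarrow> real"
  assumes h: "\<And>x. h x = (if G differentiable (at x) \<and> deriv G x \<noteq> 0 then 1 / deriv G x else 0)"
  shows "(\<lambda>y. h (inv_into I G y)) \<in> borel_measurable borel"
proof -
  note [measurable] = borel_measurable_inverse
  define d where "d x = (if x \<in> I \<and> G differentiable (at x) then deriv G x else 0)" for x
  have [measurable]: "d \<in> borel_measurable borel"
    unfolding d_def by (rule borel_measurable_deriv_on[OF open_domain cont])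
  \<comment> \<open>Both exceptional cases make \<open>d\<close> zero, and \<open>1 / 0 = 0\<close>
    agrees with the value prescribed by \<open>h\<close>. Off \<open>(0, 1)\<close> the function is
    constant.\<close>
  have "(\<lambda>y. h (inv_into I G y)) =
      (\<lambda>y. if y \<in> {0<..<1} then 1 / d (inv_into I G y) else h (SOME x. False))"
  proof
    fix y
    show "h (inv_into I G y) = (if y \<in> {0<..<1} then 1 / d (inv_into I G y) else h (SOME x. False))"
      using inverse_range[of y] inverse_junk[of y] by (auto simp: d_def h)
  qed
  also have "\<dots> \<in> borel_measurable borel" by measurable
  finally show ?thesis .
qed

lemma DERIV_inverse:
  assumes y: "y \<in> {0<..<1}" and "G differentiable (at (inv_into I G y))" "deriv G (inv_into I G y) \<noteq> 0"
  shows "(inv_into I G has_real_derivative inverse (deriv G (inv_into I G y))) (at y)"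
  by (rule DERIV_inverse_function[where f = G and a = 0 and b = 1])
     (use assms inverse_right isCont_inverse in \<open>auto simp: DERIV_deriv_iff_real_differentiable\<close>)

end

subsection \<open>Empirical moments\<close>

text \<open>Used with \<open>Suc\<close>: the sample begins at \<open>X 1\<close>, while the limit
  theorems sum from index 0. Injectivity turns a finite subfamily along \<open>f\<close> into one of
  \<open>X\<close> without repeated indices.\<close>

lemma (in prob_space) indep_vars_reindex_inj:
  fixes X :: "'i \<Rightarrow> 'a \<Rightarrow> 'b" and f :: "'j \<Rightarrow> 'i"
  assumes indep: "indep_vars (\<lambda>_. N) X UNIV" and f: "inj f"
  shows "indep_vars (\<lambda>_. N) (\<lambda>i. X (f i)) UNIV"
  unfolding indep_vars_def2
proof (intro conjI ballI indep_setsI)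
  have rv: "random_variable N (X i)" for i using indep unfolding indep_vars_def2 by blast
  then show "random_variable N (X (f i))" for i .
  show "{X (f i) -` A \<inter> space M |A. A \<in> sets N} \<subseteq> events" for i
    using rv by (auto intro: measurable_sets)
  fix A and J :: "'j set"
  assume J: "J \<noteq> {}" "finite J" "\<forall>j\<in>J. A j \<in> {X (f j) -` A \<inter> space M |A. A \<in> sets N}"
  then have "\<forall>j\<in>J. \<exists>B. B \<in> sets N \<and> A j = X (f j) -` B \<inter> space M" by blast
  then obtain B where B: "\<forall>j\<in>J. B j \<in> sets N \<and> A j = X (f j) -` B j \<inter> space M" by metis
  have inv: "inv f (f j) = j" for j using f by simp
  have "prob (\<Inter>i\<in>f ` J. X i -` B (inv f i) \<inter> space M) = (\<Prod>i\<in>f ` J. prob (X i -` B (inv f i) \<inter> space M))"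
    by (rule indep_varsD[OF indep]) (use J B inv in auto)
  moreover have "(\<Inter>i\<in>f ` J. X i -` B (inv f i) \<inter> space M) = (\<Inter>j\<in>J. A j)" using B inv by auto
  moreover have "(\<Prod>i\<in>f ` J. prob (X i -` B (inv f i) \<inter> space M)) = (\<Prod>j\<in>J. prob (A j))"
    using B inv inj_on_subset[OF f subset_UNIV] by (subst prod.reindex) auto
  ultimately show "prob (\<Inter>j\<in>J. A j) = (\<Prod>j\<in>J. prob (A j))" by simp
qed

text \<open>Chebyshev's inequality: the centred terms are orthogonal, so the variance of the average
  is \<open>v / n\<close>.\<close>

theorem (in prob_space) weak_law_of_large_numbers:
  fixes X :: "nat \<Rightarrow> 'a \<Rightarrow> real"
  assumes indep: "indep_vars (\<lambda>_. borel) X UNIV"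
    and iid: "\<And>i. distr M borel (X i) = distr M borel (X 0)"
    and sq: "integrable M (\<lambda>\<omega>. (X 0 \<omega>)\<^sup>2)"
  shows "conv_in_prob M (\<lambda>n \<omega>. (\<Sum>i<n. X i \<omega>) / real n) (expectation (X 0))"
proof (rule conv_in_probI)
  have rv[measurable]: "random_variable borel (X i)" for i
    using indep unfolding indep_vars_def2 by blast
  show "(\<lambda>\<omega>. (\<Sum>i<n. X i \<omega>) / real n) \<in> borel_measurable M" for n by measurable
  define m where "m = expectation (X 0)"
  define Y where "Y i \<omega> = X i \<omega> - m" for i \<omega>
  define v where "v = expectation (\<lambda>\<omega>. (Y 0 \<omega>)\<^sup>2)"
  have int: "integrable M (X 0)" by (rule square_integrable_imp_integrable[OF rv sq])
  have indepY: "indep_vars (\<lambda>_. borel) Y UNIV"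
    unfolding Y_def[abs_def] by (rule indep_vars_compose2[OF indep]) simp
  have intY: "integrable M (\<lambda>\<omega>. (Y i \<omega>)\<^sup>2)" "expectation (\<lambda>\<omega>. (Y i \<omega>)\<^sup>2) = v" "expectation (Y i) = 0" for i
  proof -
    have "integrable M (\<lambda>\<omega>. (Y 0 \<omega>)\<^sup>2)" using sq int by (simp add: Y_def power2_diff)
    moreover have "expectation (Y 0) = 0" using int by (simp add: Y_def[abs_def] m_def prob_space)
    ultimately show "integrable M (\<lambda>\<omega>. (Y i \<omega>)\<^sup>2)" "expectation (\<lambda>\<omega>. (Y i \<omega>)\<^sup>2) = v" "expectation (Y i) = 0"
      using iid_expectation[where V = X and i = i and f = "\<lambda>x. (x - m)\<^sup>2", OF rv rv iid]
        iid_expectation(2)[where V = X and i = i and f = "\<lambda>x. x - m", OF rv rv iid]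
      unfolding Y_def[abs_def] v_def by simp_all
  qed
  fix e d :: real assume "e > 0" "d > 0"
  have "(\<lambda>n. v / e\<^sup>2 * inverse (real n)) \<longlonglongrightarrow> v / e\<^sup>2 * 0"
    by (intro tendsto_intros lim_inverse_n)
  then have "\<forall>\<^sub>F n in sequentially. v / e\<^sup>2 * inverse (real n) < d"
    by (rule order_tendstoD) (use \<open>d > 0\<close> in simp)
  moreover have "\<forall>\<^sub>F n in sequentially. n > (0::nat)" by (rule eventually_gt_at_top)
  ultimately show "\<forall>\<^sub>F n in sequentially. prob {\<omega>\<in>space M. dist ((\<Sum>i<n. X i \<omega>) / real n) (expectation (X 0)) > e} < d"
  proof eventually_elim
    case (elim n)
    let ?D = "\<lambda>\<omega>. (\<Sum>i<n. Y i \<omega>) / real n"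
    have D: "(\<Sum>i<n. X i \<omega>) / real n - m = ?D \<omega>" for \<omega>
      using elim(2) by (simp add: Y_def sum_subtractf field_simps)
    have S: "integrable M (\<lambda>\<omega>. (\<Sum>i<n. Y i \<omega>)\<^sup>2)" "expectation (\<lambda>\<omega>. (\<Sum>i<n. Y i \<omega>)\<^sup>2) = real n * v"
      using expectation_square_sum_indep[OF finite_lessThan indep_vars_subset[OF indepY subset_UNIV] intY(1,3), of n]
      by (simp_all add: intY(2))
    have "prob {\<omega>\<in>space M. dist ((\<Sum>i<n. X i \<omega>) / real n) (expectation (X 0)) > e} \<le> prob {\<omega>\<in>space M. \<bar>?D \<omega>\<bar> \<ge> e}"
      unfolding dist_real_def m_def[symmetric] D by (intro finite_measure_mono) (auto simp: Y_def)
    also have "\<dots> \<le> expectation (\<lambda>\<omega>. (?D \<omega>)\<^sup>2) / e\<^sup>2"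
      by (rule second_moment_method) (use S \<open>e > 0\<close> in \<open>auto simp: power_divide Y_def\<close>)
    also have "\<dots> = v / e\<^sup>2 * inverse (real n)"
      using S elim(2) by (simp add: power_divide power2_eq_square field_simps)
    finally show ?case using elim(1) by simp
  qed
qed

lemma transpose_diag_mat: "transpose (diag_mat d) = diag_mat d"
  by (simp add: transpose_def diag_mat_def vec_eq_iff)

lemma diag_mat_vector_mult: "(diag_mat d *v x) $ r = d r * x $ r"
  by (simp add: diag_mat_def matrix_vector_mult_def if_distrib[of "\<lambda>x. x * _"] cong: if_cong)

lemma diag_mat_conjugate: "(diag_mat d ** A ** diag_mat e) $ r $ s = d r * A $ r $ s * e s"
  by (simp add: diag_mat_def matrix_matrix_mult_def if_distrib[of "\<lambda>x. x * _"] if_distrib[of "\<lambda>x. _ * x"] cong: if_cong)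

section \<open>Moments of the transformed sample\<close>

locale moment_sample = prob_space M + interval_bijection I G
  for M :: "'w measure" and I :: "real set" and G :: "real \<Rightarrow> real" +
  fixes X :: "nat \<Rightarrow> 'w \<Rightarrow> real"
  assumes indep: "indep_vars (\<lambda>_. borel) X UNIV"
    and iid: "\<And>i. distr M borel (X i) = distr M borel (X 0)"
    and in_domain: "AE \<omega> in M. X 0 \<omega> \<in> I"
begin

abbreviation U :: "nat \<Rightarrow> 'w \<Rightarrow> real" where "U \<equiv> U_rv I G X"
abbreviation p :: "nat \<Rightarrow> real" where "p \<equiv> p_mom M I G X"

text \<open>Exhibits \<open>U i\<close> as one fixed Borel function of \<open>X i\<close>, so that
  independence and equality of laws pass to the powers of \<open>U\<close>.\<close>

definition u :: "real \<Rightarrow> real" where "u x = (if x \<in> I then G x else 0)"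

lemma U_eq: "U i \<omega> = u (X i \<omega>)"
  by (simp add: U_rv_def u_def)

lemma X_measurable[measurable]: "X i \<in> borel_measurable M"
  using indep unfolding indep_vars_def2 by blast

lemma u_measurable[measurable]: "u \<in> borel_measurable borel"
  unfolding u_def by (intro borel_measurable_continuous_on_if cont continuous_on_const borel_open open_domain)

lemma U_measurable[measurable]: "U i \<in> borel_measurable M"
  unfolding U_eq[abs_def] by measurable

lemma U_bounds: "0 \<le> U i \<omega>" "U i \<omega> \<le> 1"
proof -
  have "x \<in> I \<Longrightarrow> G x \<in> {0<..<1}" for x using bij by (auto simp: bij_betw_def)
  then show "0 \<le> U i \<omega>" "U i \<omega> \<le> 1" by (auto simp: U_rv_def intro: less_imp_le)
qed

lemma U_power_bounds: "0 \<le> U i \<omega> ^ k" "U i \<omega> ^ k \<le> 1"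
  using U_bounds by (auto intro: power_le_one)

lemma integrable_U_power: "integrable M (\<lambda>\<omega>. U i \<omega> ^ k)"
  by (rule integrable_const_bound[where B = 1]) (use U_power_bounds in auto)

lemma p_eq: "p k = expectation (\<lambda>\<omega>. U 0 \<omega> ^ k)"
  by (simp add: p_mom_def)

text \<open>For a positive exponent the power lies strictly between 0 and 1 almost surely, and
  strict inequalities survive integration over a probability space. Hence the inverse at
  \<open>p k\<close> is a genuine point of \<open>I\<close>.\<close>

lemma p_in_range:
  assumes "k \<ge> 1"
  shows "p k \<in> {0<..<1}"
proof -
  have "AE \<omega> in M. 0 < U 0 \<omega> ^ k \<and> U 0 \<omega> ^ k < 1"
    using in_domain
  proof eventually_elim
    case (elim \<omega>)
    then have "G (X 0 \<omega>) \<in> {0<..<1}" using bij by (auto simp: bij_betw_def)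
    then show ?case using elim assms by (auto simp: U_rv_def power_less_one_iff)
  qed
  then show ?thesis
    unfolding p_eq using expectation_less[OF integrable_U_power] expectation_greater[OF integrable_U_power] by auto
qed

lemma iid_U:
  fixes f :: "real \<Rightarrow> real"
  assumes "f \<in> borel_measurable borel"
  shows "expectation (\<lambda>\<omega>. f (U i \<omega>)) = expectation (\<lambda>\<omega>. f (U 0 \<omega>))"
proof -
  have "(\<lambda>x. f (u x)) \<in> borel_measurable borel" using assms by measurable
  from iid_expectation(2)[where V = X, OF X_measurable X_measurable iid this] show ?thesis by (simp add: U_eq)
qed

lemma p_hat_measurable[measurable]: "p_hat I G X n k \<in> borel_measurable M"
  unfolding p_hat_def[abs_def] by measurable

lemma p_hat_eq: "p_hat I G X n k \<omega> = (\<Sum>i<n. U (Suc i) \<omega> ^ k) / real n"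
  by (simp add: p_hat_def sum.atLeast1_atMost_eq)

lemma indep_Suc: "indep_vars (\<lambda>_. borel) (\<lambda>i. X (Suc i)) UNIV"
  by (rule indep_vars_reindex_inj[OF indep]) simp

lemma distr_function_Suc:
  assumes [measurable]: "f \<in> borel_measurable borel"
  shows "distr M borel (\<lambda>\<omega>. f (X (Suc i) \<omega>)) = distr M borel (\<lambda>\<omega>. f (X (Suc 0) \<omega>))"
proof -
  have "distr M borel (\<lambda>\<omega>. f (X j \<omega>)) = distr (distr M borel (X j)) borel f" for j
    by (subst distr_distr) (auto simp: comp_def)
  then show ?thesis using iid by metis
qed

lemma p_hat_conv: "conv_in_prob M (\<lambda>n. p_hat I G X n k) (p k)"
proof -
  have "conv_in_prob M (\<lambda>n \<omega>. (\<Sum>i<n. U (Suc i) \<omega> ^ k) / real n) (expectation (\<lambda>\<omega>. U (Suc 0) \<omega> ^ k))"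
  proof (rule weak_law_of_large_numbers)
    show "indep_vars (\<lambda>_. borel) (\<lambda>i \<omega>. U (Suc i) \<omega> ^ k) UNIV"
      unfolding U_eq by (rule indep_vars_compose2[OF indep_Suc]) measurable
    show "distr M borel (\<lambda>\<omega>. U (Suc i) \<omega> ^ k) = distr M borel (\<lambda>\<omega>. U (Suc 0) \<omega> ^ k)" for i
      unfolding U_eq by (rule distr_function_Suc) measurable
    show "integrable M (\<lambda>\<omega>. (U (Suc 0) \<omega> ^ k)\<^sup>2)"
      unfolding power_mult[symmetric] by (rule integrable_U_power)
  qed
  moreover have "expectation (\<lambda>\<omega>. U (Suc 0) \<omega> ^ k) = p k"
    unfolding p_eq by (rule iid_U) measurable
  ultimately show ?thesis by (simp add: p_hat_eq[abs_def])
qed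

text \<open>A product of powers of \<open>U\<close> is again a power, so covariances are polynomials
  in the moments. \<open>Sigma_hat_nth\<close> is the empirical counterpart, up to the factor
  \<open>n / (n - 1)\<close>.\<close>

lemma covariance_U_power: "covariance M (\<lambda>\<omega>. U 0 \<omega> ^ j) (\<lambda>\<omega>. U 0 \<omega> ^ k) = p (j + k) - p j * p k"
proof -
  have "(U 0 \<omega> ^ j - p j) * (U 0 \<omega> ^ k - p k) = U 0 \<omega> ^ (j + k) - p k * U 0 \<omega> ^ j - p j * U 0 \<omega> ^ k + p j * p k" for \<omega>
    by (simp add: power_add algebra_simps)
  then have "covariance M (\<lambda>\<omega>. U 0 \<omega> ^ j) (\<lambda>\<omega>. U 0 \<omega> ^ k)
      = expectation (\<lambda>\<omega>. U 0 \<omega> ^ (j + k) - p k * U 0 \<omega> ^ j - p j * U 0 \<omega> ^ k + p j * p k)"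
    by (simp add: covariance_def p_eq[symmetric])
  also have "\<dots> = p (j + k) - p j * p k"
    using integrable_U_power[of 0] by (simp add: p_eq[symmetric] prob_space)
  finally show ?thesis .
qed

definition centred_powers :: "('q::finite \<Rightarrow> nat) \<Rightarrow> real \<Rightarrow> real ^ 'q" where
  "centred_powers ix x = (\<chi> r. u x ^ ix r - p (ix r))"

lemma centred_powers_nth: "centred_powers ix (X i \<omega>) $ r = U i \<omega> ^ ix r - p (ix r)"
  by (simp add: centred_powers_def U_eq)

lemma centred_powers_measurable[measurable]:
  fixes ix :: "'q::finite \<Rightarrow> nat"
  shows "centred_powers ix \<in> borel_measurable borel"
proof (rule borel_measurable_euclidean_space[THEN iffD2], intro ballI)
  fix b :: "real ^ 'q" assume "b \<in> Basis"
  then obtain r where "b = axis r 1" by (auto simp: Basis_vec_def)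
  then have "(\<lambda>x. centred_powers ix x \<bullet> b) = (\<lambda>x. u x ^ ix r - p (ix r))"
    by (simp add: centred_powers_def inner_axis)
  then show "(\<lambda>x. centred_powers ix x \<bullet> b) \<in> borel_measurable borel" by simp
qed

text \<open>The form is the variance of a linear combination of the powers. This gives the
  semidefiniteness needed for the normal law to exist as well as the variances in the central limit
  theorem.\<close>

lemma Sigma_mat_quadratic:
  "expectation (\<lambda>\<omega>. (t \<bullet> centred_powers ix (X 0 \<omega>))\<^sup>2) = t \<bullet> (Sigma_mat ix M I G X *v t)"
proof -
  let ?c = "\<lambda>r \<omega>. U 0 \<omega> ^ ix r - p (ix r)"
  have int: "integrable M (\<lambda>\<omega>. ?c r \<omega> * ?c s \<omega>)" for r s
  proof -
    have "?c r \<omega> * ?c s \<omega> = U 0 \<omega> ^ (ix r + ix s) - p (ix s) * U 0 \<omega> ^ ix r - p (ix r) * U 0 \<omega> ^ ix s + p (ix r) * p (ix s)" for \<omega>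
      by (simp add: power_add algebra_simps)
    then show ?thesis using integrable_U_power by simp
  qed
  have "(t \<bullet> centred_powers ix (X 0 \<omega>))\<^sup>2 = (\<Sum>r\<in>UNIV. \<Sum>s\<in>UNIV. (t $ r * t $ s) * (?c r \<omega> * ?c s \<omega>))" for \<omega>
    by (simp add: inner_vec_def centred_powers_nth power2_eq_square sum_product mult_ac)
  then have "expectation (\<lambda>\<omega>. (t \<bullet> centred_powers ix (X 0 \<omega>))\<^sup>2)
      = (\<Sum>r\<in>UNIV. \<Sum>s\<in>UNIV. (t $ r * t $ s) * expectation (\<lambda>\<omega>. ?c r \<omega> * ?c s \<omega>))"
    using int by simp
  also have "\<dots> = t \<bullet> (Sigma_mat ix M I G X *v t)"
    by (simp add: Sigma_mat_def covariance_def p_eq[symmetric] inner_vec_def matrix_vector_mult_def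
        sum_distrib_left mult_ac)
  finally show ?thesis .
qed

lemma moment_central_limit_theorem:
  fixes ix :: "'q::finite \<Rightarrow> nat"
  obtains N where "is_normal_law N 0 (Sigma_mat ix M I G X)"
    "weak_conv_rv M (\<lambda>n \<omega>. \<chi> r. sqrt (real n) * (p_hat I G X n (ix r) \<omega> - p (ix r))) N"
proof -
  let ?S = "Sigma_mat ix M I G X"
  have "transpose ?S = ?S"
    by (simp add: transpose_def Sigma_mat_def vec_eq_iff covariance_def mult.commute)
  moreover have "0 \<le> t \<bullet> (?S *v t)" for t
    unfolding Sigma_mat_quadratic[symmetric] by (intro integral_nonneg_AE AE_I2) simp
  ultimately obtain N where N: "is_normal_law N 0 ?S" using normal_law_exists by blast
  define V where "V i \<omega> = centred_powers ix (X (Suc i) \<omega>)" for i \<omega>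
  have norm_V: "norm (V i \<omega>) \<le> real CARD('q)" for i \<omega>
  proof -
    have "\<bar>V i \<omega> $ r\<bar> \<le> 1" for r
    proof -
      have "0 \<le> p (ix r)" "p (ix r) \<le> 1"
        unfolding p_eq using U_power_bounds integral_ge_const[OF integrable_U_power, of 0]
          integral_le_const[OF integrable_U_power, of _ _ 1] by auto
      then show ?thesis
        unfolding V_def centred_powers_nth using U_power_bounds[of "Suc i" \<omega> "ix r"] by (simp add: abs_le_iff)
    qed
    then have "(\<Sum>r\<in>UNIV. \<bar>V i \<omega> $ r\<bar>) \<le> (\<Sum>r\<in>(UNIV::'q set). 1)" by (intro sum_mono)
    then show ?thesis using norm_le_l1_cart[of "V i \<omega>"] by simp
  qed
  have rv[measurable]: "V i \<in> borel_measurable M" for i unfolding V_def by measurable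
  have "weak_conv_rv M (\<lambda>n \<omega>. (1 / sqrt (real n)) *\<^sub>R (\<Sum>i<n. V i \<omega>)) N"
  proof (rule multivariate_central_limit_theorem[OF _ _ _ _ _ N])
    show "indep_vars (\<lambda>_. borel) V UNIV"
      unfolding V_def[abs_def] by (rule indep_vars_compose2[OF indep_Suc]) measurable
    show "distr M borel (V i) = distr M borel (V 0)" for i
    proof -
      have "distr M borel (V j) = distr (distr M borel (X (Suc j))) borel (centred_powers ix)" for j
        by (subst distr_distr) (auto simp: comp_def V_def[abs_def])
      then show ?thesis using iid by metis
    qed
    show "integrable M (\<lambda>\<omega>. (norm (V 0 \<omega>))\<^sup>2)"
      by (rule integrable_const_bound[where B = "(real CARD('q))\<^sup>2"])
         (auto intro!: power_mono norm_V)
    show "expectation (V 0) = 0"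
    proof -
      have int: "integrable M (V 0)"
        by (rule integrable_const_bound[where B = "real CARD('q)"]) (use norm_V in auto)
      have "expectation (V 0) $ r = 0" for r
      proof -
        have "expectation (V 0) $ r = expectation (\<lambda>\<omega>. V 0 \<omega> $ r)"
          using integral_inner_left[of "axis r 1" M "V 0"] int by (simp add: inner_axis)
        also have "\<dots> = expectation (\<lambda>\<omega>. U (Suc 0) \<omega> ^ ix r) - p (ix r)"
          using integrable_U_power by (simp add: V_def centred_powers_nth prob_space)
        also have "expectation (\<lambda>\<omega>. U (Suc 0) \<omega> ^ ix r) = p (ix r)"
          unfolding p_eq by (rule iid_U) measurable
        finally show ?thesis by simp
      qed
      then show ?thesis by (simp add: vec_eq_iff)
    qed
    show "expectation (\<lambda>\<omega>. (t \<bullet> V 0 \<omega>)\<^sup>2) = t \<bullet> (?S *v t)" for t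
      unfolding Sigma_mat_quadratic[symmetric] V_def
      by (rule iid_expectation(2)[where V = X and f = "\<lambda>x. (t \<bullet> centred_powers ix x)\<^sup>2", OF X_measurable X_measurable iid])
         measurable
  qed
  also have "(\<lambda>n \<omega>. (1 / sqrt (real n)) *\<^sub>R (\<Sum>i<n. V i \<omega>)) =
      (\<lambda>n \<omega>. \<chi> r. sqrt (real n) * (p_hat I G X n (ix r) \<omega> - p (ix r)))"
  proof (intro ext, subst vec_eq_iff, intro allI)
    fix n \<omega> r
    have "((1 / sqrt (real n)) *\<^sub>R (\<Sum>i<n. V i \<omega>)) $ r
        = (1 / sqrt (real n)) * ((\<Sum>i<n. U (Suc i) \<omega> ^ ix r) - real n * p (ix r))"
      by (simp add: V_def centred_powers_nth sum_subtractf)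
    also have "\<dots> = sqrt (real n) * (p_hat I G X n (ix r) \<omega> - p (ix r))"
    \<comment> \<open>At \<open>n = 0\<close> both sides are 0, because \<open>1 / 0 = 0\<close> and
      \<open>sqrt 0 = 0\<close>.\<close>
    proof (cases "n = 0")
      case False
      then have "1 / sqrt (real n) = sqrt (real n) / real n" by (simp add: real_div_sqrt divide_eq_eq)
      moreover have "s / real n * (T - real n * m) = s * (T / real n - m)" for s T m :: real
        using False by (simp add: field_simps)
      ultimately show ?thesis unfolding p_hat_eq by simp
    qed simp
    finally show "((1 / sqrt (real n)) *\<^sub>R (\<Sum>i<n. V i \<omega>)) $ r
        = (\<chi> r. sqrt (real n) * (p_hat I G X n (ix r) \<omega> - p (ix r))) $ r" by simp
  qed
  finally show thesis using that N by blast
qed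

text \<open>For \<open>n = 1\<close> both sides are \<open>0\<close> because \<open>x / 0 = 0\<close>.\<close>

lemma Sigma_hat_nth:
  "Sigma_hat ix I G X n \<omega> $ r $ s = real n / (real n - 1) *
     (p_hat I G X n (ix r + ix s) \<omega> - p_hat I G X n (ix r) \<omega> * p_hat I G X n (ix s) \<omega>)"
proof (cases "n = 0")
  case True
  then show ?thesis by (simp add: Sigma_hat_def)
next
  case False
  let ?a = "\<lambda>i. U i \<omega> ^ ix r" and ?b = "\<lambda>i. U i \<omega> ^ ix s"
  define A B where AB: "A = p_hat I G X n (ix r) \<omega>" "B = p_hat I G X n (ix s) \<omega>"
  have sums: "(\<Sum>i=1..n. ?a i) = real n * A" "(\<Sum>i=1..n. ?b i) = real n * B"
    "(\<Sum>i=1..n. ?a i * ?b i) = real n * p_hat I G X n (ix r + ix s) \<omega>"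
    using False by (simp_all add: AB p_hat_def power_add)
  have "(\<Sum>i=1..n. (?a i - A) * (?b i - B)) = (\<Sum>i=1..n. ?a i * ?b i - B * ?a i - A * ?b i + A * B)"
    by (intro sum.cong refl) (simp add: algebra_simps)
  also have "\<dots> = real n * (p_hat I G X n (ix r + ix s) \<omega> - A * B)"
    by (simp only: sum.distrib sum_subtractf sum_distrib_left[symmetric] sums) (simp add: algebra_simps)
  finally show ?thesis by (simp add: Sigma_hat_def AB)
qed

lemma Sigma_hat_conv:
  "conv_in_prob M (\<lambda>n \<omega>. Sigma_hat ix I G X n \<omega> $ r $ s) (Sigma_mat ix M I G X $ r $ s)"
proof -
  have "(\<lambda>n. real (Suc n) / (real (Suc n) - 1)) \<longlonglongrightarrow> 1"
    using LIMSEQ_Suc_n_over_n[where 'a = real] by simp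
  then have "(\<lambda>n. real n / (real n - 1)) \<longlonglongrightarrow> 1" by (rule LIMSEQ_imp_Suc)
  then have "conv_in_prob M (\<lambda>n \<omega>. real n / (real n - 1) *
      (p_hat I G X n (ix r + ix s) \<omega> - p_hat I G X n (ix r) \<omega> * p_hat I G X n (ix s) \<omega>))
      (1 * (p (ix r + ix s) - p (ix r) * p (ix s)))"
    by (intro conv_in_prob_mult conv_in_prob_diff conv_in_prob_const_seq p_hat_conv prob_space_axioms)
  then show ?thesis
    by (simp only: Sigma_hat_nth) (simp add: Sigma_mat_def covariance_U_power)
qed

section \<open>Linearisation and reciprocal derivative for a single moment\<close>

context
  fixes k :: nat
  assumes k: "k \<ge> 1" and smooth: "deriv_continuous_at G (K_mom M I G X k)"
    and pos: "deriv G (K_mom M I G X k) > 0"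
begin

lemma K_hat_slutsky_remainder:
  assumes tight: "tight_rv M (\<lambda>n \<omega>. sqrt (real n) * (p_hat I G X n k \<omega> - p k))"
  shows "conv_in_prob M (\<lambda>n \<omega>. sqrt (real n) * (K_hat I G X n k \<omega> - K_mom M I G X k)
    - 1 / deriv G (K_mom M I G X k) * (sqrt (real n) * (p_hat I G X n k \<omega> - p k))) 0"
proof -
  note [measurable] = borel_measurable_inverse
  define d where "d = 1 / deriv G (K_mom M I G X k)"
  have "G differentiable (at (K_mom M I G X k))"
    using smooth by (auto simp: deriv_continuous_at_def dest: eventually_nhds_x_imp_x)
  then have "(inv_into I G has_real_derivative d) (at (p k))"
    using DERIV_inverse[OF p_in_range[OF k]] pos by (simp add: K_mom_def d_def inverse_eq_divide)
  then have lim: "((\<lambda>y. (inv_into I G y - inv_into I G (p k)) / (y - p k)) \<longlongrightarrow> d) (at (p k))"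
    by (simp add: has_field_derivative_iff)
  define H where "H y = (if y = p k then d else (inv_into I G y - inv_into I G (p k)) / (y - p k))" for y
  \<comment> \<open>An exact identity for every real \<open>y\<close>, also off
    \<open>(0, 1)\<close> where the inverse is arbitrary. The linearisation error is thus
    \<open>H - d\<close> at the empirical moment, times the scaled deviation.\<close>
  have H: "inv_into I G y - inv_into I G (p k) = H y * (y - p k)" for y
    by (simp add: H_def)
  have "\<forall>\<^sub>F y in at (p k). (inv_into I G y - inv_into I G (p k)) / (y - p k) = H y"
    by (simp add: H_def eventually_at_filter)
  then have "(H \<longlongrightarrow> H (p k)) (at (p k))"
    using Lim_transform_eventually[OF lim] by (simp add: H_def)
  then have "isCont (\<lambda>y. H y - d) (p k)" by (intro continuous_intros) (simp add: isCont_def)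
  moreover have [measurable]: "H \<in> borel_measurable borel" unfolding H_def by measurable
  ultimately have "conv_in_prob M (\<lambda>n \<omega>. H (p_hat I G X n k \<omega>) - d) (H (p k) - d)"
    by (intro conv_in_prob_isCont[OF prob_space_axioms p_hat_conv, where f = "\<lambda>y. H y - d"]) measurable
  then have "conv_in_prob M (\<lambda>n \<omega>. H (p_hat I G X n k \<omega>) - d) 0" by (simp add: H_def)
  then have "conv_in_prob M (\<lambda>n \<omega>. (H (p_hat I G X n k \<omega>) - d) * (sqrt (real n) * (p_hat I G X n k \<omega> - p k))) 0"
    by (rule conv_in_prob_mult_tight[OF prob_space_axioms _ tight]) measurable
  moreover have "(H (p_hat I G X n k \<omega>) - d) * (sqrt (real n) * (p_hat I G X n k \<omega> - p k)) =
      sqrt (real n) * (K_hat I G X n k \<omega> - K_mom M I G X k) - d * (sqrt (real n) * (p_hat I G X n k \<omega> - p k))" for n \<omega>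
    unfolding K_hat_def K_mom_def H by (simp add: algebra_simps)
  ultimately show ?thesis by (simp add: d_def)
qed

text \<open>Near the limit \<open>G\<close> is differentiable and, by continuity of the derivative,
  \<open>deriv G\<close> is positive, so the default value 0 does not occur there. Composed with the
  continuous inverse, the reciprocal derivative is continuous at \<open>p k\<close> as a function of
  the moment.\<close>

lemma reciprocal_deriv_conv:
  "conv_in_prob M (\<lambda>n \<omega>. let x = K_hat I G X n k \<omega>
     in if G differentiable (at x) \<and> deriv G x \<noteq> 0 then 1 / deriv G x else 0)
   (1 / deriv G (K_mom M I G X k))"
proof -
  let ?x = "K_mom M I G X k"
  define h where "h x = (if G differentiable (at x) \<and> deriv G x \<noteq> 0 then 1 / deriv G x else 0)" for x
  have deriv_cont: "isCont (deriv G) ?x" and diff: "\<forall>\<^sub>F y in nhds ?x. G differentiable (at y)"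
    using smooth by (auto simp: deriv_continuous_at_def)
  have "(deriv G \<longlongrightarrow> deriv G ?x) (nhds ?x)" using deriv_cont by (simp add: continuous_at tendsto_nhds_iff isCont_def)
  then have "\<forall>\<^sub>F y in nhds ?x. deriv G y > 0" using pos by (rule order_tendstoD)
  with diff have "\<forall>\<^sub>F y in nhds ?x. h y = 1 / deriv G y"
    by eventually_elim (simp add: h_def)
  then have "isCont h ?x \<longleftrightarrow> isCont (\<lambda>y. 1 / deriv G y) ?x" and hx: "h ?x = 1 / deriv G ?x"
    by (rule isCont_cong) (rule eventually_nhds_x_imp_x, fact)
  then have h: "isCont h ?x" using deriv_cont pos by (auto intro!: continuous_intros)
  have "isCont (\<lambda>y. h (inv_into I G y)) (p k)"
    using isCont_o2[OF isCont_inverse[OF p_in_range[OF k]]] h by (simp add: K_mom_def)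
  moreover have "(\<lambda>y. h (inv_into I G y)) \<in> borel_measurable borel"
    by (rule borel_measurable_reciprocal_deriv_inverse) (simp add: h_def)
  then have "(\<lambda>\<omega>. h (inv_into I G (p_hat I G X n k \<omega>))) \<in> borel_measurable M" for n
    by (rule measurable_compose[OF p_hat_measurable])
  ultimately have "conv_in_prob M (\<lambda>n \<omega>. h (inv_into I G (p_hat I G X n k \<omega>))) (h (inv_into I G (p k)))"
    by (rule conv_in_prob_isCont[OF prob_space_axioms p_hat_conv])
  then show ?thesis by (simp add: Let_def h_def[symmetric] K_hat_def K_mom_def[symmetric] hx)
qed

end

theorem kolmogorov_moments_asymptotically_normal:
  fixes ix :: "'q::finite \<Rightarrow> nat"
  assumes k: "\<And>r. ix r \<ge> 1" and smooth: "\<And>r. deriv_continuous_at G (K_mom M I G X (ix r))"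
    and pos: "\<And>r. deriv G (K_mom M I G X (ix r)) > 0"
  shows "\<exists>N. is_normal_law N 0 (D_mat ix M I G X ** Sigma_mat ix M I G X ** D_mat ix M I G X) \<and>
    weak_conv_rv M (\<lambda>n \<omega>. sqrt (real n) *\<^sub>R (K_hat_vec ix I G X n \<omega> - K_vec ix M I G X)) N"
proof -
  let ?D = "D_mat ix M I G X"
  let ?W = "\<lambda>n \<omega>. \<chi> r. sqrt (real n) * (p_hat I G X n (ix r) \<omega> - p (ix r))"
  obtain N where N: "is_normal_law N 0 (Sigma_mat ix M I G X)" and W: "weak_conv_rv M ?W N"
    by (rule moment_central_limit_theorem)
  have N': "prob_space N" "sets N = sets borel" using N by (auto simp: is_normal_law_def)
  let ?N = "distr N borel ((*v) ?D)"
  have normal: "is_normal_law ?N 0 (?D ** Sigma_mat ix M I G X ** ?D)"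
    using is_normal_law_linear_image[OF N, of ?D] by (simp add: D_mat_def transpose_diag_mat)
  have DW: "weak_conv_rv M (\<lambda>n \<omega>. ?D *v ?W n \<omega>) ?N"
    by (rule weak_conv_rv_continuous_image[OF N' W])
       (intro linear_continuous_on matrix_vector_mul_bounded_linear)
  have "weak_conv_rv M (\<lambda>n \<omega>. sqrt (real n) *\<^sub>R (K_hat_vec ix I G X n \<omega> - K_vec ix M I G X)) ?N"
  proof (rule weak_conv_rv_slutsky[OF prob_space_axioms _ _ DW])
    show "prob_space ?N" "sets ?N = sets borel" using normal by (auto simp: is_normal_law_def)
    show "conv_in_prob M (\<lambda>n \<omega>. sqrt (real n) *\<^sub>R (K_hat_vec ix I G X n \<omega> - K_vec ix M I G X) - ?D *v ?W n \<omega>) 0"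
    proof (rule conv_in_prob_vec[OF prob_space_axioms])
      fix r
      have cont: "continuous_on UNIV (\<lambda>x :: real ^ 'q. x $ r)" by (intro continuous_intros)
      then have [measurable]: "(\<lambda>x :: real ^ 'q. x $ r) \<in> borel_measurable N"
        using borel_measurable_continuous_onI N'(2) by (simp cong: measurable_cong_sets)
      \<comment> \<open>The coordinate projection is continuous, so each coordinate converges weakly
        and is tight by itself.\<close>
      have "tight_rv M (\<lambda>n \<omega>. ?W n \<omega> $ r)"
        by (rule weak_conv_rv_imp_tight[OF prob_space_axioms _ _ weak_conv_rv_continuous_image[OF N' W cont]])
           (auto intro: prob_space.prob_space_distr N')
      then have "tight_rv M (\<lambda>n \<omega>. sqrt (real n) * (p_hat I G X n (ix r) \<omega> - p (ix r)))" by simp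
      from K_hat_slutsky_remainder[OF k smooth pos this]
      show "conv_in_prob M (\<lambda>n \<omega>. (sqrt (real n) *\<^sub>R (K_hat_vec ix I G X n \<omega> - K_vec ix M I G X) - ?D *v ?W n \<omega>) $ r) (0 $ r)"
        by (simp add: D_mat_def diag_mat_vector_mult K_hat_vec_def K_vec_def)
    qed
  qed
  with normal show ?thesis by blast
qed

text \<open>Conjugation by diagonal matrices multiplies each entry by two diagonal elements, so
  every entry of the estimator is a product of three convergent real sequences.\<close>

theorem covariance_estimator_consistent:
  fixes ix :: "'q::finite \<Rightarrow> nat"
  assumes k: "\<And>r. ix r \<ge> 1" and smooth: "\<And>r. deriv_continuous_at G (K_mom M I G X (ix r))"
    and pos: "\<And>r. deriv G (K_mom M I G X (ix r)) > 0"
  shows "conv_in_prob M (\<lambda>n \<omega>. D_hat ix I G X n \<omega> ** Sigma_hat ix I G X n \<omega> ** D_hat ix I G X n \<omega>)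
    (D_mat ix M I G X ** Sigma_mat ix M I G X ** D_mat ix M I G X)"
proof (rule conv_in_prob_mat[OF prob_space_axioms])
  fix r s
  show "conv_in_prob M (\<lambda>n \<omega>. (D_hat ix I G X n \<omega> ** Sigma_hat ix I G X n \<omega> ** D_hat ix I G X n \<omega>) $ r $ s)
    ((D_mat ix M I G X ** Sigma_mat ix M I G X ** D_mat ix M I G X) $ r $ s)"
    unfolding D_hat_def D_mat_def diag_mat_conjugate
    by (intro conv_in_prob_mult prob_space_axioms Sigma_hat_conv reciprocal_deriv_conv k smooth pos)
qed

end

theorem corollary6p3:
  fixes M :: "'w measure" and P :: "real measure"
    and I :: "real set" and G :: "real \<Rightarrow> real"
    and X :: "nat \<Rightarrow> 'w \<Rightarrow> real"
    and q :: nat and ix :: "'q::finite \<Rightarrow> nat"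
  assumes "is_interval I"
    and "continuous_on I G" and "strict_mono_on I G" and "bij_betw G I {0<..<1}"
    and "prob_space M"
    and "prob_space.indep_vars M (\<lambda>_. borel) X UNIV"
    and "\<And>i. distr M borel (X i) = P"
    and "measure P I = 1"
    and "q \<ge> 1" and "bij_betw ix UNIV {1..q}"
    and "\<And>r. r \<in> {1..q} \<Longrightarrow> deriv_continuous_at G (K_mom M I G X r)"
    and "\<And>r. r \<in> {1..q} \<Longrightarrow> deriv G (K_mom M I G X r) > 0"
  shows "(\<exists>N. is_normal_law N 0 (D_mat ix M I G X ** Sigma_mat ix M I G X ** D_mat ix M I G X) \<and>
              weak_conv_rv M
                (\<lambda>n \<omega>. sqrt (real n) *\<^sub>R (K_hat_vec ix I G X n \<omega> - K_vec ix M I G X)) N)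
       \<and> conv_in_prob M
           (\<lambda>n \<omega>. D_hat ix I G X n \<omega> ** Sigma_hat ix I G X n \<omega> ** D_hat ix I G X n \<omega>)
           (D_mat ix M I G X ** Sigma_mat ix M I G X ** D_mat ix M I G X)"
proof -
  interpret prob_space M by fact
  interpret interval_bijection I G by unfold_locales fact+
  interpret moment_sample M I G X
  proof unfold_locales
    show "indep_vars (\<lambda>_. borel) X UNIV" by fact
    show "distr M borel (X i) = distr M borel (X 0)" for i using assms(7) by simp
    have [measurable]: "X 0 \<in> borel_measurable M" using assms(6) unfolding indep_vars_def2 by blast
    \<comment> \<open>Openness makes \<open>I\<close> a Borel set, which the transfer of
      \<open>measure P I = 1\<close> to the event \<open>X 0 \<omega> \<in> I\<close> uses.\<close>
    have [measurable]: "I \<in> sets borel" by (intro borel_open open_domain)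
    have "prob {\<omega>\<in>space M. X 0 \<omega> \<in> I} = measure (distr M borel (X 0)) I"
      by (subst measure_distr) (auto intro!: arg_cong[where f = prob])
    also have "\<dots> = 1" using assms(7,8) by simp
    finally show "AE \<omega> in M. X 0 \<omega> \<in> I"
      by (subst (asm) prob_Collect_eq_1) auto
  qed
  have "ix r \<in> {1..q}" for r using assms(10) by (auto simp: bij_betw_def)
  then have "\<And>r. ix r \<ge> 1" "\<And>r. deriv_continuous_at G (K_mom M I G X (ix r))"
    "\<And>r. deriv G (K_mom M I G X (ix r)) > 0"
    using assms(11,12) by auto
  then show ?thesis
    using kolmogorov_moments_asymptotically_normal covariance_estimator_consistent by blast
qed

end
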